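(* Let $M$ be a compact connected smooth manifold and let $\mathcal{F}$ be a transversely parallelizable foliation on $M$ of codimension $q$, with associated basic foliation $\mathcal{F}_b$. Then $H^1(M/\mathcal{F},\mathbb{Q}) = H^1(M/\mathcal{F}_b,\mathbb{Q})$ (as subspaces of $H^1(M,\mathbb{R})$).
   Context: Manifolds are smooth, connected and without boundary; foliations are regular. For a foliation $\mathcal{F}$ on $M$, $T\mathcal{F}\subset TM$ is the bundle of vectors tangent to the leaves, $\Gamma(\mathcal{F})$ is the Lie algebra of global vector fields tangent to the leaves, and $N\mathcal{F}=TM/T\mathcal{F}$ is the normal bundle. A vector field $Y$ on $M$ is foliate if $[\Gamma(\mathcal{F}),Y]\subset\Gamma(\mathcal{F})$; $L(M,\mathcal{F})$ is the Lie algebra of foliate vector fields and $l(M,\mathcal{F})=L(M,\mathcal{F})/\Gamma(\mathcal{F})$. A foliation $\mathcal{F}$ of codimension $q$ is transversely parallelizable if there are $\tilde Y_1,\dots,\tilde Y_q\in l(M,\mathcal{F})$ forming a global frame of $N\mathcal{F}$. Basic forms: $\Omega^k(M,\mathcal{F})=\{\alpha\in\Omega^k(M): i_X\alpha=0,\ i_Xd\alpha=0 \text{ for all } X\in\Gamma(\mathcal{F})\}$. This is a subcomplex of the de Rham complex; its cohomology is the basic cohomology $H^*(M/\mathcal{F})$. The inclusion induces an injection $H^1(M/\mathcal{F})\hookrightarrow H^1(M,\mathbb{R})$ into de Rham cohomology. One sets $H^1(M/\mathcal{F},\mathbb{Q}):=H^1(M/\mathcal{F})\cap H^1(M,\mathbb{Q})$,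 where $H^1(M,\mathbb{Q})\subset H^1(M,\mathbb{R})$ is the set of classes whose integrals over elements of $H_1(M,\mathbb{Z})$ are rational. Basic foliation: for a transversely parallelizable foliation $\mathcal{F}$ on a compact connected manifold $M$, the basic foliation $\mathcal{F}_b$ is the foliation of $M$ defined by the vector fields $X$ on $M$ satisfying $Xf=0$ for every basic function $f\in\Omega^0(M,\mathcal{F})$ (that is, $f$ smooth with $Zf=0$ for all $Z\in\Gamma(\mathcal{F})$). It is known that $M/\mathcal{F}_b$ is a manifold and $M\to M/\mathcal{F}_b$ is a fiber bundle whose fibers are the leaves of $\mathcal{F}_b$. *)

theory Defs
  imports "HOL-Analysis.Analysis" "HOL-Homology.Homology" "HOL-Library.Disjoint_Sets"
begin

section \<open>Smooth maps between normed spaces\<close>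

text \<open>Only used for open \<^term>\<open>S\<close> and a finite-dimensional domain, where it is the usual
  notion of a map of class $C^k$.\<close>

primrec Ck_on :: "nat \<Rightarrow> 'b::real_normed_vector set \<Rightarrow> ('b \<Rightarrow> 'c::real_normed_vector) \<Rightarrow> bool" where
  "Ck_on 0 S f \<longleftrightarrow> continuous_on S f"
| "Ck_on (Suc k) S f \<longleftrightarrow> (\<forall>x\<in>S. f differentiable (at x)) \<and>
     (\<forall>v. Ck_on k S (\<lambda>x. frechet_derivative f (at x) v))"

definition smooth_on :: "'b::real_normed_vector set \<Rightarrow> ('b \<Rightarrow> 'c::real_normed_vector) \<Rightarrow> bool" where
  "smooth_on S f \<longleftrightarrow> (\<forall>k. Ck_on k S f)"


section \<open>Smooth manifolds\<close>

text \<open>A chart is a pair of its domain and its coordinate map; the values of the map outside the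
  domain are irrelevant.\<close>

type_synonym ('a, 'e) chart = "'a set \<times> ('a \<Rightarrow> 'e)"

definition chart_inv :: "('a, 'e) chart \<Rightarrow> 'e \<Rightarrow> 'a" where
  "chart_inv c = inv_into (fst c) (snd c)"

definition chart_image :: "('a, 'e) chart \<Rightarrow> 'e set" where
  "chart_image c = snd c ` fst c"

definition transition :: "('a, 'e) chart \<Rightarrow> ('a, 'e) chart \<Rightarrow> 'e \<Rightarrow> 'e" where
  "transition c d = snd d \<circ> chart_inv c"

definition is_chart :: "'a topology \<Rightarrow> ('a, 'e::real_normed_vector) chart \<Rightarrow> bool" where
  "is_chart X c \<longleftrightarrow> openin X (fst c) \<and> open (chart_image c) \<and>
     homeomorphic_map (subtopology X (fst c)) (top_of_set (chart_image c)) (snd c)"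

definition compatible :: "('a, 'e::real_normed_vector) chart \<Rightarrow> ('a, 'e) chart \<Rightarrow> bool" where
  "compatible c d \<longleftrightarrow>
     smooth_on (snd c ` (fst c \<inter> fst d)) (transition c d) \<and>
     smooth_on (snd d ` (fst c \<inter> fst d)) (transition d c)"

record ('a, 'e) manifold =
  mtop :: "'a topology"
  atlas :: "('a, 'e) chart set"

abbreviation points :: "('a, 'e) manifold \<Rightarrow> 'a set" where
  "points M \<equiv> topspace (mtop M)"

text \<open>The atlas is the maximal one, that is, the smooth structure itself. The model space is an
  arbitrary finite-dimensional inner product space; unlike the class of Euclidean spaces of the
  library, the classes used here do not exclude the zero space, so that manifolds of dimension
  zero are covered. (Completeness is automatic in finite dimension.)\<close>

definition smooth_manifold :: "('a, 'e::{real_inner,banach}) manifold \<Rightarrow> bool" where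
  "smooth_manifold M \<longleftrightarrow>
     (\<exists>B::'e set. finite B \<and> span B = UNIV) \<and>
     Hausdorff_space (mtop M) \<and> second_countable (mtop M) \<and>
     \<Union>(fst ` atlas M) = points M \<and>
     (\<forall>c\<in>atlas M. is_chart (mtop M) c) \<and>
     (\<forall>c\<in>atlas M. \<forall>d\<in>atlas M. compatible c d) \<and>
     (\<forall>c. is_chart (mtop M) c \<and> (\<forall>d\<in>atlas M. compatible c d) \<longrightarrow> c \<in> atlas M)"

definition charts_at :: "('a, 'e) manifold \<Rightarrow> 'a \<Rightarrow> ('a, 'e) chart set" where
  "charts_at M p = {c \<in> atlas M. p \<in> fst c}"

definition smooth_functions :: "('a, 'e::{real_inner,banach}) manifold \<Rightarrow> ('a \<Rightarrow> real) set" where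
  "smooth_functions M = {f. \<forall>c\<in>atlas M. smooth_on (chart_image c) (f \<circ> chart_inv c)}"


section \<open>Tangent vectors and vector fields\<close>

text \<open>A tangent vector at \<^term>\<open>p\<close> is the family of its components in all charts
  around \<^term>\<open>p\<close>, related by the derivatives of the transition maps. The components in the
  remaining charts are set to zero, so that the zero family is the only tangent vector at
  a point outside the manifold.\<close>

type_synonym ('a, 'e) tvector = "('a, 'e) chart \<Rightarrow> 'e"

definition tangent_space ::
    "('a, 'e::{real_inner,banach}) manifold \<Rightarrow> 'a \<Rightarrow> ('a, 'e) tvector set" where
  "tangent_space M p =
     {v. (\<forall>c\<in>charts_at M p. \<forall>d\<in>charts_at M p.
            v d = frechet_derivative (transition c d) (at (snd c p)) (v c)) \<and>
         (\<forall>c. c \<notin> charts_at M p \<longrightarrow> v c = 0)}"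

definition coord_vector ::
    "('a, 'e::{real_inner,banach}) manifold \<Rightarrow> ('a, 'e) chart \<Rightarrow> 'a \<Rightarrow> 'e \<Rightarrow> ('a, 'e) tvector" where
  "coord_vector M c p e =
     (\<lambda>d. if d \<in> charts_at M p then frechet_derivative (transition c d) (at (snd c p)) e else 0)"

definition local_field :: "('a \<Rightarrow> ('a, 'e) tvector) \<Rightarrow> ('a, 'e) chart \<Rightarrow> 'e \<Rightarrow> 'e" where
  "local_field X c x = X (chart_inv c x) c"

definition vector_fields ::
    "('a, 'e::{real_inner,banach}) manifold \<Rightarrow> ('a \<Rightarrow> ('a, 'e) tvector) set" where
  "vector_fields M =
     {X. (\<forall>p. X p \<in> tangent_space M p) \<and>
         (\<forall>c\<in>atlas M. smooth_on (chart_image c) (local_field X c))}"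

definition lie_bracket ::
    "('a, 'e::{real_inner,banach}) manifold \<Rightarrow> ('a \<Rightarrow> ('a, 'e) tvector) \<Rightarrow>
      ('a \<Rightarrow> ('a, 'e) tvector) \<Rightarrow> 'a \<Rightarrow> ('a, 'e) tvector" where
  "lie_bracket M X Y p =
     (\<lambda>c. if c \<in> charts_at M p
          then frechet_derivative (local_field Y c) (at (snd c p)) (X p c)
             - frechet_derivative (local_field X c) (at (snd c p)) (Y p c)
          else 0)"


section \<open>Differential forms of degree zero and one\<close>

text \<open>The choice of the chart is immaterial by the chain rule. If \<^term>\<open>X\<close> is a vector
  field, then \<^term>\<open>d0 M f p (X p)\<close> is the value of $Xf$ at \<^term>\<open>p\<close>.\<close>

definition d0 ::
    "('a, 'e::{real_inner,banach}) manifold \<Rightarrow> ('a \<Rightarrow> real) \<Rightarrow> 'a \<Rightarrow> ('a, 'e) tvector \<Rightarrow> real" where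
  "d0 M f p v =
     (if p \<in> points M \<and> v \<in> tangent_space M p
      then let c = (SOME c. c \<in> charts_at M p)
           in frechet_derivative (f \<circ> chart_inv c) (at (snd c p)) (v c)
      else 0)"

definition local_coeff ::
    "('a, 'e::{real_inner,banach}) manifold \<Rightarrow> ('a \<Rightarrow> ('a, 'e) tvector \<Rightarrow> real) \<Rightarrow>
      ('a, 'e) chart \<Rightarrow> 'e \<Rightarrow> 'e \<Rightarrow> real" where
  "local_coeff M \<alpha> c e x = \<alpha> (chart_inv c x) (coord_vector M c (chart_inv c x) e)"

definition one_forms ::
    "('a, 'e::{real_inner,banach}) manifold \<Rightarrow> ('a \<Rightarrow> ('a, 'e) tvector \<Rightarrow> real) set" where
  "one_forms M =
     {\<alpha>. (\<forall>p\<in>points M. \<forall>v\<in>tangent_space M p. \<forall>w\<in>tangent_space M p. \<forall>a b.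
            \<alpha> p (\<lambda>c. a *\<^sub>R v c + b *\<^sub>R w c) = a * \<alpha> p v + b * \<alpha> p w) \<and>
         (\<forall>p v. p \<notin> points M \<or> v \<notin> tangent_space M p \<longrightarrow> \<alpha> p v = 0) \<and>
         (\<forall>c\<in>atlas M. \<forall>e. smooth_on (chart_image c) (local_coeff M \<alpha> c e))}"

text \<open>The exterior derivative of a 1-form, evaluated at \<^term>\<open>p\<close> on two tangent vectors by
  its expression in the chart \<^term>\<open>c\<close> around \<^term>\<open>p\<close>. The value does not depend
  on \<^term>\<open>c\<close>.\<close>

definition d1 ::
    "('a, 'e::{real_inner,banach}) manifold \<Rightarrow> ('a \<Rightarrow> ('a, 'e) tvector \<Rightarrow> real) \<Rightarrow>
      ('a, 'e) chart \<Rightarrow> 'a \<Rightarrow> ('a, 'e) tvector \<Rightarrow> ('a, 'e) tvector \<Rightarrow> real" where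
  "d1 M \<alpha> c p v w =
     frechet_derivative (local_coeff M \<alpha> c (w c)) (at (snd c p)) (v c)
   - frechet_derivative (local_coeff M \<alpha> c (v c)) (at (snd c p)) (w c)"

definition closed_forms ::
    "('a, 'e::{real_inner,banach}) manifold \<Rightarrow> ('a \<Rightarrow> ('a, 'e) tvector \<Rightarrow> real) set" where
  "closed_forms M =
     {\<alpha> \<in> one_forms M. \<forall>p\<in>points M. \<forall>c\<in>charts_at M p.
        \<forall>v\<in>tangent_space M p. \<forall>w\<in>tangent_space M p. d1 M \<alpha> c p v w = 0}"


section \<open>De Rham cohomology in degree one\<close>

definition cohomologous_via ::
    "('a, 'e::{real_inner,banach}) manifold \<Rightarrow> ('a \<Rightarrow> real) set \<Rightarrow>
      ('a \<Rightarrow> ('a, 'e) tvector \<Rightarrow> real) set \<Rightarrow>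
      (('a \<Rightarrow> ('a, 'e) tvector \<Rightarrow> real) \<times> ('a \<Rightarrow> ('a, 'e) tvector \<Rightarrow> real)) set" where
  "cohomologous_via M \<Omega>0 Z1 =
     {(\<alpha>, \<beta>). \<alpha> \<in> Z1 \<and> \<beta> \<in> Z1 \<and> (\<exists>f\<in>\<Omega>0. \<beta> = (\<lambda>p v. \<alpha> p v + d0 M f p v))}"

definition deRham_rel ::
    "('a, 'e::{real_inner,banach}) manifold \<Rightarrow>
      (('a \<Rightarrow> ('a, 'e) tvector \<Rightarrow> real) \<times> ('a \<Rightarrow> ('a, 'e) tvector \<Rightarrow> real)) set" where
  "deRham_rel M = cohomologous_via M (smooth_functions M) (closed_forms M)"

definition deRham_H1 ::
    "('a, 'e::{real_inner,banach}) manifold \<Rightarrow> ('a \<Rightarrow> ('a, 'e) tvector \<Rightarrow> real) set set" where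
  "deRham_H1 M = closed_forms M // deRham_rel M"


section \<open>Integration over singular 1-cycles and rational classes\<close>

definition simplex_path :: "((nat \<Rightarrow> real) \<Rightarrow> 'a) \<Rightarrow> real \<Rightarrow> 'a" where
  "simplex_path \<sigma> t = \<sigma> (\<lambda>i. if i = 0 then 1 - t else if i = 1 then t else 0)"

text \<open>A path on the closed unit interval is smooth if it extends to a smooth curve on an open
  interval.\<close>

definition smooth_path :: "('a, 'e::{real_inner,banach}) manifold \<Rightarrow> (real \<Rightarrow> 'a) \<Rightarrow> bool" where
  "smooth_path M \<gamma> \<longleftrightarrow>
     (\<exists>\<epsilon>>0. \<exists>g. continuous_map (top_of_set {-\<epsilon><..<1+\<epsilon>}) (mtop M) g \<and>
        (\<forall>c\<in>atlas M. smooth_on {t \<in> {-\<epsilon><..<1+\<epsilon>}. g t \<in> fst c} (snd c \<circ> g)) \<and>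
        (\<forall>t\<in>{0..1}. g t = \<gamma> t))"

definition velocity ::
    "('a, 'e::{real_inner,banach}) manifold \<Rightarrow> (real \<Rightarrow> 'a) \<Rightarrow> real \<Rightarrow> ('a, 'e) tvector" where
  "velocity M \<gamma> t =
     (\<lambda>c. if c \<in> charts_at M (\<gamma> t)
          then vector_derivative (snd c \<circ> \<gamma>) (at t within {0..1}) else 0)"

definition line_integral ::
    "('a, 'e::{real_inner,banach}) manifold \<Rightarrow> ('a \<Rightarrow> ('a, 'e) tvector \<Rightarrow> real) \<Rightarrow>
      (real \<Rightarrow> 'a) \<Rightarrow> real" where
  "line_integral M \<alpha> \<gamma> = integral {0..1} (\<lambda>t. \<alpha> (\<gamma> t) (velocity M \<gamma> t))"

definition smooth_chain :: "('a, 'e::{real_inner,banach}) manifold \<Rightarrow> 'a chain \<Rightarrow> bool" where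
  "smooth_chain M z \<longleftrightarrow> (\<forall>\<sigma>\<in>Poly_Mapping.keys z. smooth_path M (simplex_path \<sigma>))"

definition chain_integral ::
    "('a, 'e::{real_inner,banach}) manifold \<Rightarrow> ('a \<Rightarrow> ('a, 'e) tvector \<Rightarrow> real) \<Rightarrow>
      'a chain \<Rightarrow> real" where
  "chain_integral M \<alpha> z =
     (\<Sum>\<sigma>\<in>Poly_Mapping.keys z.
        of_int (Poly_Mapping.lookup z \<sigma>) * line_integral M \<alpha> (simplex_path \<sigma>))"

text \<open>An element of the homology group is a set of homologous singular cycles. The integral of
  a closed form over it is the integral over any smooth cycle in this set: smooth cycles exist in
  every homology class, and the value depends neither on the choice of the smooth cycle nor on
  that of the closed form in its class.\<close>

definition rational_H1 ::
    "('a, 'e::{real_inner,banach}) manifold \<Rightarrow> ('a \<Rightarrow> ('a, 'e) tvector \<Rightarrow> real) set set" where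
  "rational_H1 M =
     {A \<in> deRham_H1 M. \<forall>h\<in>carrier (homology_group 1 (mtop M)).
        \<forall>z\<in>h. smooth_chain M z \<longrightarrow> (\<forall>\<alpha>\<in>A. chain_integral M \<alpha> z \<in> \<rat>)}"


section \<open>Foliations\<close>

text \<open>A foliation is given by its set of leaves. A chart is adapted to it, with a linear
  subspace \<^term>\<open>W\<close> as the direction of the plaques, if the path components of the
  intersections of the leaves with its domain correspond to the slices parallel to
  \<^term>\<open>W\<close>. Taking path components, and requiring leaves to be path connected in the topology
  of the manifold, excludes unions of several dense leaves, which may well be connected.\<close>

definition adapted_chart ::
    "('a, 'e::{real_inner,banach}) manifold \<Rightarrow> 'a set set \<Rightarrow> ('a, 'e) chart \<Rightarrow> 'e set \<Rightarrow> bool" where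
  "adapted_chart M F c W \<longleftrightarrow> c \<in> atlas M \<and> subspace W \<and>
     (\<forall>L\<in>F. \<forall>K\<in>path_components_of (subtopology (mtop M) (L \<inter> fst c)).
        \<exists>a. snd c ` K = {x \<in> chart_image c. x - a \<in> W})"

definition foliation :: "('a, 'e::{real_inner,banach}) manifold \<Rightarrow> nat \<Rightarrow> 'a set set \<Rightarrow> bool" where
  "foliation M q F \<longleftrightarrow>
     partition_on (points M) F \<and>
     (\<forall>L\<in>F. path_connectedin (mtop M) L) \<and>
     (\<forall>p\<in>points M. \<exists>c W. p \<in> fst c \<and> adapted_chart M F c W \<and>
        dim W + q = dim (UNIV :: 'e set))"

definition leaf_tangent ::
    "('a, 'e::{real_inner,banach}) manifold \<Rightarrow> 'a set set \<Rightarrow> 'a \<Rightarrow> ('a, 'e) tvector set" where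
  "leaf_tangent M F p =
     {v \<in> tangent_space M p. \<exists>c W. p \<in> fst c \<and> adapted_chart M F c W \<and> v c \<in> W}"

definition tangent_fields ::
    "('a, 'e::{real_inner,banach}) manifold \<Rightarrow> 'a set set \<Rightarrow> ('a \<Rightarrow> ('a, 'e) tvector) set" where
  "tangent_fields M F = {X \<in> vector_fields M. \<forall>p\<in>points M. X p \<in> leaf_tangent M F p}"

definition foliate_fields ::
    "('a, 'e::{real_inner,banach}) manifold \<Rightarrow> 'a set set \<Rightarrow> ('a \<Rightarrow> ('a, 'e) tvector) set" where
  "foliate_fields M F =
     {Y \<in> vector_fields M. \<forall>X\<in>tangent_fields M F. lie_bracket M X Y \<in> tangent_fields M F}"

definition transverse_fields ::
    "('a, 'e::{real_inner,banach}) manifold \<Rightarrow> 'a set set \<Rightarrow> ('a \<Rightarrow> ('a, 'e) tvector) set set" where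
  "transverse_fields M F =
     foliate_fields M F //
       {(Y, Y'). Y \<in> foliate_fields M F \<and> Y' \<in> foliate_fields M F \<and>
          (\<lambda>p c. Y' p c - Y p c) \<in> tangent_fields M F}"

definition normal_rel ::
    "('a, 'e::{real_inner,banach}) manifold \<Rightarrow> 'a set set \<Rightarrow> 'a \<Rightarrow>
      (('a, 'e) tvector \<times> ('a, 'e) tvector) set" where
  "normal_rel M F p =
     {(v, w). v \<in> tangent_space M p \<and> w \<in> tangent_space M p \<and>
        (\<lambda>c. w c - v c) \<in> leaf_tangent M F p}"

definition normal_space ::
    "('a, 'e::{real_inner,banach}) manifold \<Rightarrow> 'a set set \<Rightarrow> 'a \<Rightarrow> ('a, 'e) tvector set set" where
  "normal_space M F p = tangent_space M p // normal_rel M F p"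

text \<open>The frame condition says that every element of the normal space at \<^term>\<open>p\<close> is in
  exactly one way a linear combination of the classes of the \<^term>\<open>Y i p\<close>. These classes
  only depend on the classes of the fields \<^term>\<open>Y i\<close> modulo the fields tangent to the
  leaves.\<close>

definition transversely_parallelizable ::
    "('a, 'e::{real_inner,banach}) manifold \<Rightarrow> nat \<Rightarrow> 'a set set \<Rightarrow> bool" where
  "transversely_parallelizable M q F \<longleftrightarrow>
     (\<exists>Yt. (\<forall>i<q. Yt i \<in> transverse_fields M F) \<and>
        (\<forall>Y. (\<forall>i<q. Y i \<in> Yt i) \<longrightarrow>
           (\<forall>p\<in>points M. \<forall>n\<in>normal_space M F p. \<exists>!a. a \<in> {..<q} \<rightarrow>\<^sub>E UNIV \<and>
              n = normal_rel M F p `` {\<lambda>c. \<Sum>i<q. a i *\<^sub>R Y i p c})))"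


section \<open>Basic forms, basic cohomology and the basic foliation\<close>

definition basic_functions ::
    "('a, 'e::{real_inner,banach}) manifold \<Rightarrow> 'a set set \<Rightarrow> ('a \<Rightarrow> real) set" where
  "basic_functions M F =
     {f \<in> smooth_functions M. \<forall>X\<in>tangent_fields M F. \<forall>p\<in>points M. d0 M f p (X p) = 0}"

definition basic_one_forms ::
    "('a, 'e::{real_inner,banach}) manifold \<Rightarrow> 'a set set \<Rightarrow>
      ('a \<Rightarrow> ('a, 'e) tvector \<Rightarrow> real) set" where
  "basic_one_forms M F =
     {\<alpha> \<in> one_forms M. \<forall>X\<in>tangent_fields M F. \<forall>p\<in>points M.
        \<alpha> p (X p) = 0 \<and>
        (\<forall>c\<in>charts_at M p. \<forall>w\<in>tangent_space M p. d1 M \<alpha> c p (X p) w = 0)}"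

definition basic_H1 ::
    "('a, 'e::{real_inner,banach}) manifold \<Rightarrow> 'a set set \<Rightarrow>
      ('a \<Rightarrow> ('a, 'e) tvector \<Rightarrow> real) set set" where
  "basic_H1 M F =
     (basic_one_forms M F \<inter> closed_forms M) //
       cohomologous_via M (basic_functions M F) (basic_one_forms M F \<inter> closed_forms M)"

text \<open>The map from basic to de Rham cohomology that is induced by the inclusion: all elements of
  a basic class lie in the same de Rham class.\<close>

definition basic_to_deRham ::
    "('a, 'e::{real_inner,banach}) manifold \<Rightarrow> ('a \<Rightarrow> ('a, 'e) tvector \<Rightarrow> real) set \<Rightarrow>
      ('a \<Rightarrow> ('a, 'e) tvector \<Rightarrow> real) set" where
  "basic_to_deRham M A = deRham_rel M `` A"

definition basic_H1_rational ::
    "('a, 'e::{real_inner,banach}) manifold \<Rightarrow> 'a set set \<Rightarrow>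
      ('a \<Rightarrow> ('a, 'e) tvector \<Rightarrow> real) set set" where
  "basic_H1_rational M F = basic_to_deRham M ` basic_H1 M F \<inter> rational_H1 M"

text \<open>A foliation is determined by its tangent spaces, so there is at most one foliation
  \<^term>\<open>Fb\<close> that is the basic foliation of \<^term>\<open>F\<close>. The fields that annihilate the
  basic functions form a vector space, so that no linear span is needed.\<close>

definition basic_foliation ::
    "('a, 'e::{real_inner,banach}) manifold \<Rightarrow> 'a set set \<Rightarrow> 'a set set \<Rightarrow> bool" where
  "basic_foliation M F Fb \<longleftrightarrow>
     (\<exists>r. foliation M r Fb) \<and>
     (\<forall>p\<in>points M. leaf_tangent M Fb p =
        {X p | X. X \<in> vector_fields M \<and>
           (\<forall>f\<in>basic_functions M F. \<forall>x\<in>points M. d0 M f x (X x) = 0)})"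

end

theory Submission
  imports Defs
begin

text \<open>A closed basic 1-form $\alpha$ with rational periods has local primitives which differ by
  rational numbers on overlaps, once they are normalised by integration from a base point. Since $M$ is
  compact, finitely many values suffice, so these numbers have a common denominator $N$, and
  $\cos (2 \pi N f)$ and $\sin (2 \pi N f)$ are globally defined functions for the multivalued
  primitive $f$. As $\alpha$ vanishes on $T\mathcal{F}$, they are basic functions, so every vector
  tangent to $\mathcal{F}_b$ annihilates them, and hence $\alpha$. Conversely $\mathcal{F}_b$-basic
  forms are $\mathcal{F}$-basic because $\Gamma(\mathcal{F}) \subset \Gamma(\mathcal{F}_b)$.\<close>

section \<open>The Poincare lemma for 1-forms\<close>

text \<open>The difference of two primitives is only locally constant, and the overlap of two
  neighbourhoods may have infinitely many components, so a finite cover does not by itself bound the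
  denominators. Each neighbourhood is therefore shrunk to a compact one: on compact overlaps a
  locally constant function takes finitely many values. Rationality is a condition on smooth cycles,
  hence the base point is joined to the other points by smooth singular chains; two such chains with
  the same ends differ by a smooth cycle, whose integral is a period. The chains are sums of
  straight segments in charts, so that no corners have to be smoothed. Both cosine and sine are kept
  because the differential of one of them alone also vanishes at the zeros of the other.\<close>

lemma coordinates_finite_dim:
  fixes B :: "'e::real_inner set"
  assumes "finite B" "span B = UNIV"
  obtains C :: "'e set" and u where "finite C" "\<And>x. x = (\<Sum>b\<in>C. (x \<bullet> u b) *\<^sub>R b)"
proof -
  obtain C :: "'e set" where C: "finite C" "span C = UNIV" "pairwise orthogonal C"
    using basis_orthogonal[OF assms(1)] assms(2) by metis
  \<comment> \<open>The dual family of an orthogonal spanning set. If \<open>C\<close> contains 0,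
    the corresponding \<open>u b\<close> is 0 as well, and its summand vanishes.\<close>
  define u where "u b = b /\<^sub>R (b \<bullet> b)" for b :: 'e
  have "x = (\<Sum>b\<in>C. (x \<bullet> u b) *\<^sub>R b)" for x
  proof -
    have "x \<in> span C" using C by simp
    then show ?thesis
    proof (induction rule: span_induct_alt)
      case base
      then show ?case by simp
    next
      case (step c x y)
      have "(\<Sum>b\<in>C. (x \<bullet> u b) *\<^sub>R b) = (\<Sum>b\<in>C. if b = x then x else 0)"
        using C(3) step
        by (cases "x = 0"; intro sum.cong) (auto simp: u_def pairwise_def orthogonal_def)
      also have "\<dots> = x"
        using C(1) step by simp
      finally have "c *\<^sub>R x + y = c *\<^sub>R (\<Sum>b\<in>C. (x \<bullet> u b) *\<^sub>R b) + (\<Sum>b\<in>C. (y \<bullet> u b) *\<^sub>R b)"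
        using step by simp
      then show ?case
        unfolding inner_add_left inner_scaleR_left scaleR_add_left sum.distrib scaleR_sum_right
          scaleR_scaleR .
    qed
  qed
  with C(1) show ?thesis by (rule that)
qed

text \<open>The potential is the integral of the form over the segment from the base point.\<close>

lemma poincare_one_form:
  fixes A :: "'e::{real_inner,banach} \<Rightarrow> 'e \<Rightarrow> real"
  assumes fin: "finite B" "span B = (UNIV :: 'e set)"
    and S: "open S" "convex S"
    and lin: "\<And>x. x \<in> S \<Longrightarrow> linear (A x)"
    and C1: "\<And>e. Ck_on (Suc 0) S (\<lambda>x. A x e)"
    and sym: "\<And>x v w. x \<in> S \<Longrightarrow>
      frechet_derivative (\<lambda>x. A x w) (at x) v = frechet_derivative (\<lambda>x. A x v) (at x) w"
  shows "\<exists>F. \<forall>x\<in>S. (F has_derivative A x) (at x)"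
proof (cases "S = {}")
  case False
  then obtain x0 where x0: "x0 \<in> S" by blast
  obtain C :: "'e set" and u where C: "finite C" "\<And>x. x = (\<Sum>b\<in>C. (x \<bullet> u b) *\<^sub>R b)"
    using coordinates_finite_dim[OF fin] by metis
  have lin_sum: "g h = (\<Sum>b\<in>C. (h \<bullet> u b) * g b)" if "linear g" for g :: "'e \<Rightarrow> real" and h
    by (subst C(2)[of h]) (simp add: linear_sum[OF that] linear_cmul[OF that])
  define D where "D e x = frechet_derivative (\<lambda>x. A x e) (at x)" for e x
  have D: "((\<lambda>x. A x e) has_derivative D e x) (at x)" if "x \<in> S" for e x
    using C1[of e] that unfolding D_def by (simp add: frechet_derivative_works)
  have contD: "continuous_on S (\<lambda>x. D e x v)" for e v
    using C1[of e] by (simp add: D_def)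
  have contA: "continuous_on S (\<lambda>x. A x e)" for e
    by (intro continuous_at_imp_continuous_on ballI has_derivative_continuous[OF D])
  have linD: "linear (D e x)" if "x \<in> S" for e x
    using D[OF that] has_derivative_linear by blast
  have symD: "D w x v = D v x w" if "x \<in> S" for x v w
    using sym[OF that] by (simp add: D_def)
  define \<gamma> where "\<gamma> x t = x0 + t *\<^sub>R (x - x0)" for x and t :: real
  have \<gamma>: "\<gamma> x t \<in> S" if "x \<in> S" "t \<in> {0..1}" for x t
    using convexD_alt[OF S(2) x0 that(1), of t] that(2)
    by (simp add: \<gamma>_def algebra_simps)
  define f where "f x t = (\<Sum>b\<in>C. ((x - x0) \<bullet> u b) * A (\<gamma> x t) b)" for x t
  \<comment> \<open>The derivative of \<open>f\<close> in \<open>x\<close>, as a bounded linear map.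
    The integrand and its derivative are expanded in coordinates because only the functions
    \<open>A x e\<close> with fixed \<open>e\<close> are known to be continuously differentiable;
    finite sums of them give the continuity in operator norm that the Leibniz rule asks for.\<close>
  define fx where "fx x t = (\<Sum>b\<in>C. A (\<gamma> x t) b *\<^sub>R blinfun_inner_right (u b) +
    (\<Sum>b'\<in>C. (((x - x0) \<bullet> u b) * t * D b (\<gamma> x t) b') *\<^sub>R blinfun_inner_right (u b')))" for x t
  have fx_apply: "blinfun_apply (fx x t) h =
      (\<Sum>b\<in>C. (h \<bullet> u b) * A (\<gamma> x t) b + ((x - x0) \<bullet> u b) * (t * D b (\<gamma> x t) h))"
    if "x \<in> S" "t \<in> {0..1}" for x t h
    unfolding fx_def blinfun.sum_left
  proof (intro sum.cong refl)
    fix b assume "b \<in> C"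
    show "blinfun_apply (A (\<gamma> x t) b *\<^sub>R blinfun_inner_right (u b) + (\<Sum>b'\<in>C.
        (((x - x0) \<bullet> u b) * t * D b (\<gamma> x t) b') *\<^sub>R blinfun_inner_right (u b'))) h =
        h \<bullet> u b * A (\<gamma> x t) b + (x - x0) \<bullet> u b * (t * D b (\<gamma> x t) h)"
      by (subst lin_sum[OF linD[OF \<gamma>[OF that]], of b h])
        (simp add: blinfun.add_left blinfun.sum_left blinfun.scaleR_left inner_commute
          sum_distrib_left mult_ac)
  qed
  \<comment> \<open>Here closedness enters: \<open>symD\<close> exchanges the direction
    \<open>h\<close> with \<open>x - x0\<close>, and the right-hand side becomes the derivative of
    \<open>t * A (\<gamma> x t) h\<close> with respect to \<open>t\<close>.\<close>
  have fx_eq: "blinfun_apply (fx x t) h = A (\<gamma> x t) h + t * D h (\<gamma> x t) (x - x0)"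
    if "x \<in> S" "t \<in> {0..1}" for x t h
  proof -
    have "D h (\<gamma> x t) (x - x0) = (\<Sum>b\<in>C. ((x - x0) \<bullet> u b) * D b (\<gamma> x t) h)"
      using lin_sum[OF linD[OF \<gamma>[OF that]], of h "x - x0"] symD[OF \<gamma>[OF that]] by simp
    then show ?thesis
      using lin_sum[OF lin[OF \<gamma>[OF that]], of h]
      by (simp add: fx_apply[OF that] sum.distrib sum_distrib_left mult_ac)
  qed
  have cont\<gamma>: "continuous_on X (\<lambda>p. \<gamma> (fst p) (snd p))" for X
    unfolding \<gamma>_def by (intro continuous_intros)
  have comp: "continuous_on (S \<times> cbox 0 1) (\<lambda>p. g (\<gamma> (fst p) (snd p)))"
    if "continuous_on S g" for g :: "'e \<Rightarrow> real"
    by (rule continuous_on_compose2[OF that cont\<gamma>]) (use \<gamma> in \<open>auto simp: cbox_interval\<close>)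
  have contfx: "continuous_on (S \<times> cbox 0 1) (\<lambda>(x, t). fx x t)"
    unfolding fx_def case_prod_unfold by (intro continuous_intros comp contA contD)
  have "continuous_on (S \<times> cbox 0 1) (\<lambda>p. f (fst p) (snd p))"
    unfolding f_def by (intro continuous_intros comp contA)
  note contf' = this
  have pair: "continuous_on (cbox 0 1) (Pair x)" for x :: 'e
    by (rule continuous_on_Pair[OF continuous_on_const continuous_on_id])
  have contf: "continuous_on (cbox 0 1) (f x)" if "x \<in> S" for x
    using continuous_on_compose2[OF contf' pair, of x] that by auto
  have contfx1: "continuous_on (cbox 0 1) (fx x)" if "x \<in> S" for x
    using continuous_on_compose2[OF contfx pair, of x] that by auto
  have fder: "((\<lambda>x. f x t) has_derivative blinfun_apply (fx x t)) (at x within S)"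
    if "x \<in> S" "t \<in> cbox 0 1" for x t
  proof -
    have t: "t \<in> {0..1}" using that by simp
    have "((\<lambda>x. A (\<gamma> x t) b) has_derivative (\<lambda>h. D b (\<gamma> x t) (t *\<^sub>R h))) (at x)" for b
      by (rule has_derivative_compose[of "\<lambda>x. \<gamma> x t" _ x UNIV "\<lambda>x. A x b", OF _ D[OF \<gamma>[OF that(1) t]]])
        (auto simp: \<gamma>_def intro!: derivative_eq_intros)
    then have "((\<lambda>x. A (\<gamma> x t) b) has_derivative (\<lambda>h. t * D b (\<gamma> x t) h)) (at x)" for b
      by (simp add: linear_cmul[OF linD[OF \<gamma>[OF that(1) t]]])
    then have "((\<lambda>x. f x t) has_derivative (\<lambda>h. \<Sum>b\<in>C. ((x - x0) \<bullet> u b) * (t * D b (\<gamma> x t) h) +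
        (h \<bullet> u b) * A (\<gamma> x t) b)) (at x)"
      unfolding f_def by (intro has_derivative_sum has_derivative_mult) (auto intro!: derivative_eq_intros)
    moreover have "(\<lambda>h. \<Sum>b\<in>C. ((x - x0) \<bullet> u b) * (t * D b (\<gamma> x t) h) +
        (h \<bullet> u b) * A (\<gamma> x t) b) = blinfun_apply (fx x t)"
      by (rule ext) (simp add: fx_apply[OF that(1) t] add.commute)
    ultimately show ?thesis
      by (simp add: has_derivative_at_withinI)
  qed
  have "((\<lambda>x. integral (cbox 0 1) (f x)) has_derivative A x) (at x)" if x: "x \<in> S" for x
  proof -
    have "((\<lambda>x. integral (cbox 0 1) (f x)) has_derivative integral (cbox 0 1) (fx x)) (at x within S)"
      by (rule leibniz_rule[OF fder integrable_continuous[OF contf] contfx x S(2)])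
    moreover have "blinfun_apply (integral (cbox 0 1) (fx x)) h = A x h" for h
    proof -
      have "((\<lambda>t. t * A (\<gamma> x t) h) has_vector_derivative blinfun_apply (fx x t) h)
          (at t within {0..1})" if t: "t \<in> {0..1}" for t
      proof -
        have "((\<lambda>t. A (\<gamma> x t) h) has_derivative (\<lambda>s. D h (\<gamma> x t) (s *\<^sub>R (x - x0)))) (at t within {0..1})"
          by (rule has_derivative_compose[of "\<lambda>t. \<gamma> x t", OF _ D[OF \<gamma>[OF x t]]])
            (auto simp: \<gamma>_def intro!: derivative_eq_intros)
        then have "((\<lambda>t. A (\<gamma> x t) h) has_vector_derivative D h (\<gamma> x t) (x - x0)) (at t within {0..1})"
          by (simp add: has_vector_derivative_def linear_cmul[OF linD[OF \<gamma>[OF x t]]])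
        then show ?thesis
          unfolding fx_eq[OF x t]
          by (auto intro!: derivative_eq_intros)
      qed
      \<comment> \<open>The lower boundary term carries the factor 0, and
        \<open>\<gamma> x 1 = x\<close>, so that only \<open>A x h\<close> remains.\<close>
      then have "((\<lambda>t. blinfun_apply (fx x t) h) has_integral (1 * A (\<gamma> x 1) h - 0 * A (\<gamma> x 0) h)) {0..1}"
        by (intro fundamental_theorem_of_calculus) auto
      then have "integral {0..1} (\<lambda>t. blinfun_apply (fx x t) h) = A x h"
        by (simp add: \<gamma>_def integral_unique)
      then show ?thesis
        using integrable_continuous[OF contfx1[OF x]] by (simp add: blinfun_apply_integral)
    qed
    ultimately show ?thesis
      using at_within_open[OF x S(1)] by (metis ext)
  qed
  then show ?thesis by blast
qed auto


section \<open>Maps of class $C^k$\<close>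

lemma has_derivative_cong_open:
  assumes "open S" "x \<in> S" "\<And>y. y \<in> S \<Longrightarrow> f y = g y"
  shows "(f has_derivative D) (at x) \<longleftrightarrow> (g has_derivative D) (at x)"
  using assms has_derivative_transform_within_open[of f D x UNIV S g]
    has_derivative_transform_within_open[of g D x UNIV S f] by auto

lemma Ck_on_cong:
  assumes "open S" "\<And>y. y \<in> S \<Longrightarrow> f y = g y"
  shows "Ck_on k S f \<longleftrightarrow> Ck_on k S g"
  using assms(2)
proof (induction k arbitrary: f g)
  case 0
  then show ?case by (simp cong: continuous_on_cong)
next
  case (Suc k)
  have *: "(f has_derivative D) (at x) \<longleftrightarrow> (g has_derivative D) (at x)" if "x \<in> S" for x D
    using has_derivative_cong_open[OF assms(1) that] Suc.prems by blast
  have "Ck_on k S (\<lambda>x. frechet_derivative f (at x) v) \<longleftrightarrow>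
      Ck_on k S (\<lambda>x. frechet_derivative g (at x) v)" for v
    by (rule Suc.IH) (simp add: frechet_derivative_def *)
  then show ?case
    using * by (simp add: differentiable_def)
qed

text \<open>The recursion of \<open>Ck_on\<close> runs through \<open>frechet_derivative\<close>; on
  an open set any explicitly known derivative can take its place. The closure rules below are read
  off from derivative formulas in this way.\<close>

lemma Ck_on_SucI:
  assumes "open S" "\<And>x. x \<in> S \<Longrightarrow> (f has_derivative f' x) (at x)"
    and "\<And>v. Ck_on k S (\<lambda>x. f' x v)"
  shows "Ck_on (Suc k) S f"
proof -
  have "Ck_on k S (\<lambda>x. frechet_derivative f (at x) v)" for v
    using Ck_on_cong[OF assms(1), of "\<lambda>x. frechet_derivative f (at x) v" "\<lambda>x. f' x v" k]
      assms(2,3) frechet_derivative_at by metis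
  then show ?thesis
    using assms(2) by (auto simp: differentiable_def)
qed

lemma Ck_on_SucD: "Ck_on (Suc k) S f \<Longrightarrow> Ck_on k S f"
proof (induction k arbitrary: f)
  case 0
  then show ?case
    by (auto intro!: differentiable_imp_continuous_on simp: differentiable_on_def differentiable_at_withinI)
next
  case (Suc k)
  from Suc.prems show ?case
    by (subst Ck_on.simps) (auto intro!: Suc.IH)
qed

lemma Ck_on_subset: "Ck_on k S f \<Longrightarrow> T \<subseteq> S \<Longrightarrow> Ck_on k T f"
  by (induction k arbitrary: f) (auto intro: continuous_on_subset)

lemma Ck_on_has_derivative:
  "Ck_on (Suc k) S f \<Longrightarrow> x \<in> S \<Longrightarrow> (f has_derivative frechet_derivative f (at x)) (at x)"
  by (simp add: frechet_derivative_works)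

lemma Ck_on_const: "open S \<Longrightarrow> Ck_on k S (\<lambda>x. a)"
  by (induction k arbitrary: a) (auto intro: continuous_on_const)

lemma Ck_on_add:
  assumes "open S" "Ck_on k S f" "Ck_on k S g"
  shows "Ck_on k S (\<lambda>x. f x + g x)"
  using assms(2,3)
proof (induction k arbitrary: f g)
  case 0
  then show ?case by (simp add: continuous_on_add)
next
  case (Suc k)
  show ?case
    by (rule Ck_on_SucI[OF assms(1) has_derivative_add[OF Ck_on_has_derivative[OF Suc.prems(1)]
        Ck_on_has_derivative[OF Suc.prems(2)]]]) (use Suc in auto)
qed

lemma Ck_on_mult:
  fixes f g :: "'b::real_normed_vector \<Rightarrow> real"
  assumes "open S" "Ck_on k S f" "Ck_on k S g"
  shows "Ck_on k S (\<lambda>x. f x * g x)"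
  using assms(2,3)
proof (induction k arbitrary: f g)
  case 0
  then show ?case by (simp add: continuous_on_mult)
next
  case (Suc k)
  show ?case
    by (rule Ck_on_SucI[OF assms(1) has_derivative_mult[OF Ck_on_has_derivative[OF Suc.prems(1)]
        Ck_on_has_derivative[OF Suc.prems(2)]]])
      (use Suc Ck_on_SucD[OF Suc.prems(1)] Ck_on_SucD[OF Suc.prems(2)]
        in \<open>auto intro!: Ck_on_add[OF assms(1)] Suc.IH\<close>)
qed

text \<open>The derivative of an affine map is constant, so differentiating the composition yields
  functions of the same shape and the induction closes. This case of the chain rule suffices because
  the paths constructed later are straight segments in charts.\<close>

lemma Ck_on_affine:
  assumes "open T" "\<And>t. t \<in> T \<Longrightarrow> u + t *\<^sub>R w \<in> S" "Ck_on k S f"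
  shows "Ck_on k T (\<lambda>t::real. f (u + t *\<^sub>R w))"
  using assms(3)
proof (induction k arbitrary: f)
  case 0
  then show ?case
    using assms(2) by (auto intro!: continuous_on_compose2[of S f] continuous_intros)
next
  case (Suc k)
  show ?case
  proof (rule Ck_on_SucI[OF assms(1)])
    fix t assume "t \<in> T"
    then show "((\<lambda>t. f (u + t *\<^sub>R w)) has_derivative
        (\<lambda>s. frechet_derivative f (at (u + t *\<^sub>R w)) (s *\<^sub>R w))) (at t)"
      by (intro has_derivative_compose[of "\<lambda>t. u + t *\<^sub>R w" "\<lambda>s. s *\<^sub>R w" t UNIV f]
          Ck_on_has_derivative[OF Suc.prems assms(2)]) (auto intro!: derivative_eq_intros)
  next
    show "Ck_on k T (\<lambda>t. frechet_derivative f (at (u + t *\<^sub>R w)) (s *\<^sub>R w))" for s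
      using Suc.IH[of "\<lambda>x. frechet_derivative f (at x) (s *\<^sub>R w)"] Suc.prems by simp
  qed
qed

text \<open>A bootstrap: the derivatives of \<open>c\<close> and \<open>s\<close> are products of
  \<open>A\<close> with \<open>s\<close> and \<open>c\<close>, so if both are of class $C^k$, both
  are of class $C^{k+1}$. The equations are coupled, which forces a simultaneous induction.
  Smoothness of an underlying angle function never has to be established.\<close>

lemma smooth_on_trig_pair:
  fixes A :: "'b::real_normed_vector \<Rightarrow> 'b \<Rightarrow> real"
  assumes S: "open S"
    and c: "\<And>x. x \<in> S \<Longrightarrow> (c has_derivative (\<lambda>e. - (\<kappa> * s x * A x e))) (at x)"
    and s: "\<And>x. x \<in> S \<Longrightarrow> (s has_derivative (\<lambda>e. \<kappa> * c x * A x e)) (at x)"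
    and A: "\<And>e. smooth_on S (\<lambda>x. A x e)"
  shows "smooth_on S c \<and> smooth_on S s"
proof -
  have "Ck_on k S c \<and> Ck_on k S s" for k
  proof (induction k)
    case 0
    then show ?case
      by (auto intro!: continuous_at_imp_continuous_on has_derivative_continuous[OF c]
          has_derivative_continuous[OF s])
  next
    case (Suc k)
    have "Ck_on k S (\<lambda>x. (- \<kappa>) * s x * A x e)" "Ck_on k S (\<lambda>x. \<kappa> * c x * A x e)" for e
      by (intro Ck_on_mult[OF S] Ck_on_const[OF S]; use Suc A in \<open>simp add: smooth_on_def\<close>)+
    then have "Ck_on k S (\<lambda>x. - (\<kappa> * s x * A x e))" "Ck_on k S (\<lambda>x. \<kappa> * c x * A x e)" for e
      by simp_all
    then show ?case
      by (intro conjI Ck_on_SucI[OF S c] Ck_on_SucI[OF S s])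
  qed
  then show ?thesis by (simp add: smooth_on_def)
qed

lemma smooth_on_has_derivative:
  "smooth_on S f \<Longrightarrow> x \<in> S \<Longrightarrow> (f has_derivative frechet_derivative f (at x)) (at x)"
  by (metis Ck_on_has_derivative smooth_on_def)


section \<open>Charts and tangent vectors\<close>

locale smooth_mfd =
  fixes M :: "('a, 'e::{real_inner,banach}) manifold"
  assumes smooth_manifold: "smooth_manifold M"
begin

abbreviation dtrans :: "('a, 'e) chart \<Rightarrow> ('a, 'e) chart \<Rightarrow> 'a \<Rightarrow> 'e \<Rightarrow> 'e" where
  "dtrans c d p \<equiv> frechet_derivative (transition c d) (at (snd c p))"

lemma is_chart: "c \<in> atlas M \<Longrightarrow> is_chart (mtop M) c"
  using smooth_manifold by (simp add: smooth_manifold_def)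

lemma charts_atD:
  assumes "c \<in> charts_at M p"
  shows "c \<in> atlas M" "p \<in> fst c" "p \<in> points M" "snd c p \<in> chart_image c"
proof -
  show c: "c \<in> atlas M" and p: "p \<in> fst c"
    using assms by (simp_all add: charts_at_def)
  show "p \<in> points M"
    using is_chart[OF c] p openin_subset unfolding is_chart_def by blast
  show "snd c p \<in> chart_image c"
    using p by (simp add: chart_image_def)
qed

lemma chart_exists: "p \<in> points M \<Longrightarrow> \<exists>c. c \<in> charts_at M p"
  using smooth_manifold unfolding smooth_manifold_def charts_at_def by blast

lemma openin_chart: "c \<in> atlas M \<Longrightarrow> openin (mtop M) (fst c)"
  and open_chart_image: "c \<in> atlas M \<Longrightarrow> open (chart_image c)"
  by (drule is_chart, simp only: is_chart_def)+

lemma chart_homeomorphic: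
  "c \<in> atlas M \<Longrightarrow> homeomorphic_map (subtopology (mtop M) (fst c)) (top_of_set (chart_image c)) (snd c)"
  by (drule is_chart, simp only: is_chart_def)+

lemma topspace_chart: "c \<in> atlas M \<Longrightarrow> topspace (subtopology (mtop M) (fst c)) = fst c"
  by (simp add: openin_chart openin_subset Int_absorb1)

lemma chart_inj: "c \<in> atlas M \<Longrightarrow> inj_on (snd c) (fst c)"
  using chart_homeomorphic homeomorphic_imp_injective_map topspace_chart by metis

lemma chart_inv_left [simp]: "c \<in> atlas M \<Longrightarrow> p \<in> fst c \<Longrightarrow> chart_inv c (snd c p) = p"
  by (simp add: chart_inv_def chart_inj)

lemma chart_inv_right [simp]: "x \<in> chart_image c \<Longrightarrow> snd c (chart_inv c x) = x"
  and chart_inv_in [simp]: "x \<in> chart_image c \<Longrightarrow> chart_inv c x \<in> fst c"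
  by (simp_all add: chart_inv_def chart_image_def f_inv_into_f inv_into_into)

lemma continuous_map_chart_inv:
  assumes "c \<in> atlas M"
  shows "continuous_map (top_of_set (chart_image c)) (mtop M) (chart_inv c)"
proof -
  obtain g where g: "homeomorphic_maps (subtopology (mtop M) (fst c)) (top_of_set (chart_image c)) (snd c) g"
    using chart_homeomorphic[OF assms] homeomorphic_map_maps by blast
  then have "continuous_map (top_of_set (chart_image c)) (mtop M) g"
    by (auto simp: homeomorphic_maps_def continuous_map_in_subtopology)
  moreover have "g x = chart_inv c x" if "x \<in> chart_image c" for x
  proof -
    have "g x \<in> fst c" "snd c (g x) = x"
      using g that topspace_chart[OF assms]
      by (auto simp: homeomorphic_maps_def continuous_map_def)
    then show ?thesis
      using chart_inv_left[OF assms] by metis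
  qed
  ultimately show ?thesis
    by (rule continuous_map_eq) simp
qed

lemma continuous_map_chart:
  "c \<in> atlas M \<Longrightarrow> continuous_map (subtopology (mtop M) (fst c)) euclidean (snd c)"
  using chart_homeomorphic homeomorphic_imp_continuous_map continuous_map_into_fulltopology by blast

lemma open_image_chart:
  assumes "c \<in> atlas M" "openin (mtop M) U"
  shows "open (snd c ` (fst c \<inter> U))"
proof -
  have "openin (top_of_set (chart_image c)) (snd c ` (fst c \<inter> U))"
    using homeomorphic_imp_open_map[OF chart_homeomorphic[OF assms(1)]] assms
    by (auto simp: open_map_def openin_subtopology_Int2)
  then show ?thesis
    using open_chart_image[OF assms(1)] openin_open_trans by blast
qed

lemma openin_image_chart_inv:
  assumes "c \<in> atlas M" "open V" "V \<subseteq> chart_image c"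
  shows "openin (mtop M) (chart_inv c ` V)"
proof -
  have "chart_inv c ` V = {p \<in> fst c. snd c p \<in> V}"
    using assms by (force intro: image_eqI[of _ _ "snd c _"])
  moreover have "openin (subtopology (mtop M) (fst c)) {p \<in> fst c. snd c p \<in> V}"
    using openin_continuous_map_preimage[OF continuous_map_chart[OF assms(1)], of V] assms(2)
    unfolding topspace_chart[OF assms(1)] by simp
  ultimately show ?thesis
    using openin_chart[OF assms(1)] openin_trans_full by metis
qed

lemma smooth_on_transition:
  "c \<in> atlas M \<Longrightarrow> d \<in> atlas M \<Longrightarrow> smooth_on (snd c ` (fst c \<inter> fst d)) (transition c d)"
  using smooth_manifold by (simp add: smooth_manifold_def compatible_def)

lemma transition_has_derivative:
  assumes "c \<in> charts_at M p" "d \<in> charts_at M p"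
  shows "(transition c d has_derivative dtrans c d p) (at (snd c p))"
  by (rule smooth_on_has_derivative[OF smooth_on_transition])
    (use charts_atD[OF assms(1)] charts_atD[OF assms(2)] in auto)

text \<open>On the overlap, \<open>f \<circ> chart_inv d\<close> is
  \<open>f \<circ> chart_inv c\<close> after the transition from \<open>d\<close> to
  \<open>c\<close>, so a derivative found in one chart determines it in all. With \<open>f\<close> a
  coordinate map this is also the cocycle rule \<open>dtrans_trans\<close>.\<close>

lemma has_derivative_change_chart:
  assumes cd: "c \<in> charts_at M p" "d \<in> charts_at M p"
    and f: "(f \<circ> chart_inv c has_derivative D) (at (snd c p))"
  shows "(f \<circ> chart_inv d has_derivative (\<lambda>e. D (dtrans d c p e))) (at (snd d p))"
proof -
  have tp: "transition d c (snd d p) = snd c p"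
    using charts_atD[OF cd(1)] charts_atD[OF cd(2)] by (simp add: transition_def)
  have 1: "((\<lambda>x. (f \<circ> chart_inv c) (transition d c x)) has_derivative (\<lambda>e. D (dtrans d c p e))) (at (snd d p))"
    by (rule has_derivative_compose[OF transition_has_derivative[OF cd(2,1)]]) (unfold tp, rule f)
  have 2: "(f \<circ> chart_inv c) (transition d c x) = (f \<circ> chart_inv d) x"
    if "x \<in> snd d ` (fst d \<inter> fst c)" for x
    using that charts_atD(1)[OF cd(1)] charts_atD(1)[OF cd(2)] by (auto simp: transition_def)
  have "open (snd d ` (fst d \<inter> fst c))" "snd d p \<in> snd d ` (fst d \<inter> fst c)"
    using charts_atD(1,2)[OF cd(1)] charts_atD(1,2)[OF cd(2)] openin_chart open_image_chart by auto
  then show ?thesis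
    by (rule has_derivative_transform_within_open[OF 1 _ _ 2])
qed

lemma dtrans_refl:
  assumes "c \<in> charts_at M p"
  shows "dtrans c c p = (\<lambda>e. e)"
proof -
  have "((\<lambda>x. x) has_derivative (\<lambda>e. e)) (at (snd c p))" by simp
  then have "(transition c c has_derivative (\<lambda>e. e)) (at (snd c p))"
    by (rule has_derivative_transform_within_open[OF _ open_chart_image])
      (use charts_atD[OF assms] in \<open>auto simp: transition_def\<close>)
  then show ?thesis
    by (metis frechet_derivative_at)
qed

lemma dtrans_trans:
  assumes "c \<in> charts_at M p" "d \<in> charts_at M p" "d' \<in> charts_at M p"
  shows "dtrans d d' p (dtrans c d p e) = dtrans c d' p e"
proof -
  have "(transition c d' has_derivative (\<lambda>e. dtrans d d' p (dtrans c d p e))) (at (snd c p))"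
    using has_derivative_change_chart[OF assms(2,1), of "snd d'"] transition_has_derivative[OF assms(2,3)]
    by (simp add: transition_def)
  then show ?thesis
    using frechet_derivative_at by metis
qed

lemma dtrans_linear:
  "c \<in> charts_at M p \<Longrightarrow> d \<in> charts_at M p \<Longrightarrow> linear (dtrans c d p)"
  using transition_has_derivative has_derivative_linear by blast

lemma coord_vector_tangent:
  "c \<in> charts_at M p \<Longrightarrow> coord_vector M c p e \<in> tangent_space M p"
  by (auto simp: tangent_space_def coord_vector_def dtrans_trans)

lemma coord_vector_apply:
  "d \<in> charts_at M p \<Longrightarrow> coord_vector M c p e d = dtrans c d p e"
  by (simp add: coord_vector_def)

lemma coord_vector_self [simp]: "c \<in> charts_at M p \<Longrightarrow> coord_vector M c p e c = e"
  by (simp add: coord_vector_def dtrans_refl)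

lemma tangent_space_dtrans:
  assumes "v \<in> tangent_space M p" "c \<in> charts_at M p" "d \<in> charts_at M p"
  shows "dtrans c d p (v c) = v d"
proof -
  have "\<forall>c\<in>charts_at M p. \<forall>d\<in>charts_at M p. v d = dtrans c d p (v c)"
    using assms(1) unfolding tangent_space_def by blast
  then show ?thesis
    using assms(2,3) by metis
qed

lemma tangent_space_outside: "v \<in> tangent_space M p \<Longrightarrow> c \<notin> charts_at M p \<Longrightarrow> v c = 0"
  unfolding tangent_space_def by blast

lemma tangent_eq_coord_vector:
  "v \<in> tangent_space M p \<Longrightarrow> c \<in> charts_at M p \<Longrightarrow> coord_vector M c p (v c) = v"
  by (rule ext) (simp add: coord_vector_def tangent_space_dtrans tangent_space_outside)

lemma coord_vector_change:
  "c \<in> charts_at M p \<Longrightarrow> d \<in> charts_at M p \<Longrightarrow> coord_vector M d p (dtrans c d p e) = coord_vector M c p e"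
  by (rule ext) (simp add: coord_vector_def dtrans_trans)

lemma coord_vector_linear_comb:
  assumes "c \<in> charts_at M p"
  shows "coord_vector M c p (a *\<^sub>R e + b *\<^sub>R e') =
    (\<lambda>d. a *\<^sub>R coord_vector M c p e d + b *\<^sub>R coord_vector M c p e' d)"
  by (rule ext) (simp add: coord_vector_def linear_add[OF dtrans_linear[OF assms]]
      linear_cmul[OF dtrans_linear[OF assms]])

text \<open>\<open>d0\<close> is computed in a chart picked by \<open>SOME\<close>. The changes of
  the derivative of \<open>f\<close> and of the components of \<open>v\<close> cancel, so any chart
  in which a derivative is known may be used instead.\<close>

lemma d0_eq:
  assumes c: "c \<in> charts_at M p" and v: "v \<in> tangent_space M p"
    and f: "(f \<circ> chart_inv c has_derivative D) (at (snd c p))"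
  shows "d0 M f p v = D (v c)"
proof -
  define d where "d = (SOME c. c \<in> charts_at M p)"
  have d: "d \<in> charts_at M p"
    unfolding d_def using c by (rule someI)
  have "frechet_derivative (f \<circ> chart_inv d) (at (snd d p)) = (\<lambda>e. D (dtrans d c p e))"
    using has_derivative_change_chart[OF c d f] frechet_derivative_at by metis
  moreover have "dtrans d c p (v d) = v c"
    by (rule tangent_space_dtrans[OF v d c])
  ultimately show ?thesis
    using v charts_atD(3)[OF c] by (simp add: d0_def d_def)
qed

end


section \<open>Local primitives\<close>

text \<open>The singular 0-simplex at \<open>p\<close>. Singular simplices are extensional
  functions; the \<open>restrict\<close> makes the faces of a 1-simplex literally equal to such
  simplices.\<close>

definition point_simplex :: "'a \<Rightarrow> (nat \<Rightarrow> real) \<Rightarrow> 'a" where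
  "point_simplex p = restrict (\<lambda>_. p) (standard_simplex 0)"

lemma standard_simplex_0D: "s \<in> standard_simplex 0 \<Longrightarrow> s 0 = 1"
  by (simp add: standard_simplex_def)

lemma chain_boundary_path:
  assumes "\<And>s. s \<in> standard_simplex 1 \<Longrightarrow> \<sigma> s = g (s 1)"
  shows "chain_boundary 1 (frag_of \<sigma>) = frag_of (point_simplex (g 1)) - frag_of (point_simplex (g 0))"
proof -
  \<comment> \<open>Face \<open>k\<close> inserts a 0 at position \<open>k\<close>, so coordinate 1
    is 1 on face 0 and 0 on face 1. Thus face 0 is the end of the path and face 1 its start, which
    fixes the signs.\<close>
  have "\<sigma> (simplical_face k s) = g (if k = 0 then 1 else 0)"
    if "s \<in> standard_simplex 0" "k \<le> 1" for s k
  proof -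
    have "simplical_face k s \<in> standard_simplex 1"
      using simplical_face_in_standard_simplex[of 1 k s] that by simp
    moreover have "simplical_face k s 1 = (if k = 0 then 1 else 0)"
      using that by (auto simp: simplical_face_def standard_simplex_0D)
    ultimately show ?thesis
      using assms by simp
  qed
  from this[of _ 0] this[of _ 1]
  have "singular_face 1 0 \<sigma> = point_simplex (g 1)" "singular_face 1 1 \<sigma> = point_simplex (g 0)"
    by (auto simp: singular_face_def point_simplex_def intro!: restrict_ext)
  then show ?thesis
    by (simp add: chain_boundary_of)
qed

text \<open>\<open>simplex_path\<close> evaluates at the vector (1 - t, t, 0, ...), whose coordinate
  1 is \<open>t\<close>; hence paths are turned into simplices through \<open>s 1\<close>.\<close>

lemma simplex_path_restrict:
  assumes "t \<in> {0..1}"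
  shows "simplex_path (restrict (\<lambda>s. g (s 1)) (standard_simplex 1)) t = g t"
proof -
  have "(\<lambda>i. if i = 0 then 1 - t else if i = 1 then t else 0) \<in> standard_simplex 1"
    using assms by (auto simp: standard_simplex_def)
  then show ?thesis by (simp add: simplex_path_def)
qed

lemma open_interval_around_unit:
  fixes T :: "real set"
  assumes "open T" "{0..1} \<subseteq> T"
  obtains \<epsilon> where "\<epsilon> > 0" "{-\<epsilon><..<1+\<epsilon>} \<subseteq> T"
proof -
  have "0 \<in> T" "1 \<in> T" using assms(2) by auto
  then obtain a b where ab: "a > 0" "ball 0 a \<subseteq> T" "b > 0" "ball 1 b \<subseteq> T"
    using assms(1) open_contains_ball by metis
  have sub: "t \<in> T" if "- min a b < t" "t < 1 + min a b" for t
  proof -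
    have "t \<in> ball 0 a \<or> t \<in> {0..1} \<or> t \<in> ball 1 b"
      using that by (auto simp: dist_real_def)
    then show ?thesis using ab assms(2) by auto
  qed
  then show ?thesis
    using ab sub by (intro that[of "min a b"]) auto
qed

lemma continuous_map_simplex_coordinate:
  "continuous_map (subtopology (powertop_real UNIV) (standard_simplex p)) euclideanreal (\<lambda>s. s i)"
  by (intro continuous_map_from_subtopology continuous_map_product_projection) simp

lemma linear_one_form:
  assumes "\<alpha> \<in> one_forms M" "p \<in> points M" "v \<in> tangent_space M p" "w \<in> tangent_space M p"
  shows "\<alpha> p (\<lambda>c. a *\<^sub>R v c + b *\<^sub>R w c) = a * \<alpha> p v + b * \<alpha> p w"
  using assms unfolding one_forms_def by blast

section \<open>Primitives in a chart and their differences as integrals along segments\<close>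

context smooth_mfd
begin

text \<open>This is df = \<alpha> on \<open>U\<close>. It uses \<open>has_derivative\<close> in
  charts because an equation for \<open>d0\<close>, which is built on
  \<open>frechet_derivative\<close>, would not assert differentiability. The values of
  \<open>f\<close> outside \<open>U\<close> are arbitrary.\<close>

definition primitive_on ::
    "('a \<Rightarrow> ('a, 'e) tvector \<Rightarrow> real) \<Rightarrow> 'a set \<Rightarrow> ('a \<Rightarrow> real) \<Rightarrow> bool" where
  "primitive_on \<alpha> U f \<longleftrightarrow> openin (mtop M) U \<and> (\<forall>p\<in>U. \<forall>c\<in>charts_at M p.
     (f \<circ> chart_inv c has_derivative (\<lambda>e. \<alpha> p (coord_vector M c p e))) (at (snd c p)))"

lemma chart_inv_charts_at: "c \<in> atlas M \<Longrightarrow> x \<in> chart_image c \<Longrightarrow> c \<in> charts_at M (chart_inv c x)"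
  by (simp add: charts_at_def)

lemma linear_one_form_coord:
  assumes \<alpha>: "\<alpha> \<in> one_forms M" and c: "c \<in> charts_at M p"
  shows "linear (\<lambda>e. \<alpha> p (coord_vector M c p e))"
proof -
  have *: "\<alpha> p (coord_vector M c p (a *\<^sub>R v + b *\<^sub>R w)) =
      a * \<alpha> p (coord_vector M c p v) + b * \<alpha> p (coord_vector M c p w)" for a b v w
    unfolding coord_vector_linear_comb[OF c]
    by (intro linear_one_form[OF \<alpha>] charts_atD[OF c] coord_vector_tangent[OF c])
  show ?thesis
  proof (rule linearI)
    show "\<alpha> p (coord_vector M c p (v + w)) = \<alpha> p (coord_vector M c p v) + \<alpha> p (coord_vector M c p w)" for v w
      using *[of 1 v 1 w] by simp
    show "\<alpha> p (coord_vector M c p (a *\<^sub>R v)) = a *\<^sub>R \<alpha> p (coord_vector M c p v)" for a v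
      using *[of a v 0 v] by simp
  qed
qed

text \<open>A potential in the coordinates of one chart is enough: under a change of chart its
  derivative transforms exactly as the coordinate vectors do in
  \<open>coord_vector_change\<close>.\<close>

lemma primitive_on_chartI:
  assumes c: "c \<in> atlas M" and V: "open V" "V \<subseteq> chart_image c"
    and F: "\<And>x. x \<in> V \<Longrightarrow> (F has_derivative (\<lambda>e. local_coeff M \<alpha> c e x)) (at x)"
  shows "primitive_on \<alpha> (chart_inv c ` V) (F \<circ> snd c)"
  unfolding primitive_on_def
proof (intro conjI ballI)
  show "openin (mtop M) (chart_inv c ` V)"
    by (rule openin_image_chart_inv[OF c V])
  fix p d assume "p \<in> chart_inv c ` V" and d: "d \<in> charts_at M p"
  then obtain x where x: "x \<in> V" "p = chart_inv c x" by blast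
  then have cp: "c \<in> charts_at M p" and sp: "snd c p = x"
    using V(2) c by (auto simp: charts_at_def)
  have "(F \<circ> snd c \<circ> chart_inv c has_derivative (\<lambda>e. local_coeff M \<alpha> c e x)) (at x)"
    by (rule has_derivative_transform_within_open[OF F[OF x(1)] V(1) x(1)]) (use V(2) in auto)
  from has_derivative_change_chart[OF cp d, of "F \<circ> snd c", unfolded sp, OF this]
  show "(F \<circ> snd c \<circ> chart_inv d has_derivative (\<lambda>e. \<alpha> p (coord_vector M d p e))) (at (snd d p))"
    by (simp add: local_coeff_def coord_vector_change[OF d cp] flip: x(2))
qed

text \<open>The coordinate vector of \<open>v\<close> has the component \<open>v\<close> in the
  chart \<open>c\<close>, so the vanishing of \<open>d1\<close> on coordinate vectors is the
  symmetry hypothesis of \<open>poincare_one_form\<close>.\<close>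

lemma chart_convex_primitive:
  assumes \<alpha>: "\<alpha> \<in> closed_forms M" and c: "c \<in> atlas M" and V: "open V" "convex V" "V \<subseteq> chart_image c"
  shows "\<exists>F. \<forall>x\<in>V. (F has_derivative (\<lambda>e. local_coeff M \<alpha> c e x)) (at x)"
proof -
  obtain B :: "'e set" where B: "finite B" "span B = UNIV"
    using smooth_manifold by (auto simp: smooth_manifold_def)
  have \<alpha>1: "\<alpha> \<in> one_forms M"
    using \<alpha> by (simp add: closed_forms_def)
  show ?thesis
  proof (rule poincare_one_form[OF B V(1,2)])
    fix x assume "x \<in> V"
    then have x: "x \<in> chart_image c" using V(3) by blast
    note cp = chart_inv_charts_at[OF c x]
    show "linear (\<lambda>e. local_coeff M \<alpha> c e x)"
      unfolding local_coeff_def by (rule linear_one_form_coord[OF \<alpha>1 cp])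
    show "frechet_derivative (\<lambda>x. local_coeff M \<alpha> c w x) (at x) v =
        frechet_derivative (\<lambda>x. local_coeff M \<alpha> c v x) (at x) w" for v w
    proof -
      have "d1 M \<alpha> c (chart_inv c x) (coord_vector M c (chart_inv c x) v)
          (coord_vector M c (chart_inv c x) w) = 0"
        using \<alpha> cp charts_atD(3)[OF cp] coord_vector_tangent[OF cp]
        by (simp add: closed_forms_def)
      then show ?thesis
        by (simp add: d1_def cp x)
    qed
  next
    have "smooth_on (chart_image c) (local_coeff M \<alpha> c e)" for e
      using \<alpha>1 c by (simp add: one_forms_def)
    then show "Ck_on (Suc 0) V (\<lambda>x. local_coeff M \<alpha> c e x)" for e
      unfolding smooth_on_def by (intro Ck_on_subset[OF _ V(3)]) blast
  qed
qed

text \<open>The link between potentials and homology: the straight segment in the chart is a smooth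
  singular simplex, and the fundamental theorem of calculus turns the integral of \<alpha> along it
  into a difference of values of the potential.\<close>

lemma chart_segment:
  assumes c: "c \<in> atlas M" and V: "open V" "convex V" "V \<subseteq> chart_image c"
    and F: "\<And>x. x \<in> V \<Longrightarrow> (F has_derivative (\<lambda>e. local_coeff M \<alpha> c e x)) (at x)"
    and ab: "a \<in> chart_inv c ` V" "b \<in> chart_inv c ` V"
  shows "\<exists>\<sigma>. singular_simplex 1 (mtop M) \<sigma> \<and> smooth_path M (simplex_path \<sigma>) \<and>
    chain_boundary 1 (frag_of \<sigma>) = frag_of (point_simplex b) - frag_of (point_simplex a) \<and>
    line_integral M \<alpha> (simplex_path \<sigma>) = F (snd c b) - F (snd c a)"
proof -
  define u where "u = snd c a"
  define w where "w = snd c b - snd c a"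
  have uV: "u \<in> V" "u + w \<in> V" "chart_inv c u = a" "chart_inv c (u + w) = b"
    using ab V(3) unfolding u_def w_def by auto
  define g where "g t = chart_inv c (u + t *\<^sub>R w)" for t :: real
  define \<sigma> where "\<sigma> = restrict (\<lambda>s. g (s 1)) (standard_simplex 1)"
  have seg: "u + t *\<^sub>R w \<in> V" if "t \<in> {0..1}" for t
    using convexD_alt[OF V(2) uV(1,2), of t] that by (simp add: algebra_simps)
  have contaff: "continuous_map euclideanreal euclidean (\<lambda>t. u + t *\<^sub>R w)"
    by (simp add: continuous_intros)
  have "continuous_map (subtopology (powertop_real UNIV) (standard_simplex 1))
      (top_of_set (chart_image c)) ((\<lambda>t. u + t *\<^sub>R w) \<circ> (\<lambda>s. s 1))"
    using seg V(3)
    by (intro continuous_map_into_subtopology continuous_map_compose[OF continuous_map_simplex_coordinate contaff])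
      (auto simp: standard_simplex_def)
  from continuous_map_compose[OF this continuous_map_chart_inv[OF c]]
  have cont: "continuous_map (subtopology (powertop_real UNIV) (standard_simplex 1)) (mtop M) (\<lambda>s. g (s 1))"
    by (simp add: g_def o_def)
  have "continuous_map (subtopology (powertop_real UNIV) (standard_simplex 1)) (mtop M) \<sigma>"
    by (rule continuous_map_eq[OF cont]) (simp add: \<sigma>_def)
  then have simplex: "singular_simplex 1 (mtop M) \<sigma>"
    by (simp add: singular_simplex_def \<sigma>_def)
  have path: "simplex_path \<sigma> t = g t" if "t \<in> {0..1}" for t
    unfolding \<sigma>_def by (rule simplex_path_restrict[OF that])
  have boundary: "chain_boundary 1 (frag_of \<sigma>) = frag_of (point_simplex b) - frag_of (point_simplex a)"
    using chain_boundary_path[of \<sigma> g] uV by (simp add: \<sigma>_def g_def)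
  \<comment> \<open>Since \<open>V\<close> is open, the segment can be prolonged beyond both ends
    inside \<open>V\<close>; this gives the curve on an open interval that
    \<open>smooth_path\<close> requires.\<close>
  define T where "T = {t. u + t *\<^sub>R w \<in> V}"
  have "open T"
    unfolding T_def by (intro open_vimage[of V "\<lambda>t. u + t *\<^sub>R w", unfolded vimage_def] V(1) continuous_intros)
  moreover have "{0..1} \<subseteq> T"
    using seg by (auto simp: T_def)
  ultimately obtain \<epsilon> where \<epsilon>: "\<epsilon> > 0" "{-\<epsilon><..<1+\<epsilon>} \<subseteq> T"
    by (rule open_interval_around_unit)
  let ?I = "{-\<epsilon><..<1+\<epsilon>}"
  have "continuous_map (top_of_set ?I) (top_of_set (chart_image c)) (\<lambda>t. u + t *\<^sub>R w)"
    using \<epsilon>(2) V(3)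
    by (intro continuous_map_into_subtopology continuous_map_from_subtopology[OF contaff]) (auto simp: T_def)
  from continuous_map_compose[OF this continuous_map_chart_inv[OF c]]
  have contI: "continuous_map (top_of_set ?I) (mtop M) g"
    by (simp add: g_def[abs_def] o_def)
  have smooth: "smooth_on {t \<in> ?I. g t \<in> fst d} (snd d \<circ> g)" if d: "d \<in> atlas M" for d
  proof -
    let ?J = "{t \<in> ?I. g t \<in> fst d}"
    have "openin (top_of_set ?I) ?J"
      using openin_continuous_map_preimage[OF contI openin_chart[OF d]] by simp
    then have J: "open ?J"
      by (rule openin_open_trans) simp
    have "Ck_on k ?J (\<lambda>t. transition c d (u + t *\<^sub>R w))" for k
    proof (rule Ck_on_affine[OF J])
      fix t assume t: "t \<in> ?J"
      then have "u + t *\<^sub>R w \<in> chart_image c"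
        using \<epsilon>(2) V(3) by (auto simp: T_def)
      then show "u + t *\<^sub>R w \<in> snd c ` (fst c \<inter> fst d)"
        using t by (intro image_eqI[of _ _ "g t"]) (auto simp: g_def)
    next
      show "Ck_on k (snd c ` (fst c \<inter> fst d)) (transition c d)"
        using smooth_on_transition[OF c d] by (simp add: smooth_on_def)
    qed
    then show ?thesis
      by (simp add: smooth_on_def transition_def g_def o_def)
  qed
  have smooth_path: "smooth_path M (simplex_path \<sigma>)"
    unfolding smooth_path_def
    by (rule exI[of _ \<epsilon>], intro conjI \<epsilon>(1), rule exI[of _ g]) (use contI smooth path in auto)
  \<comment> \<open>In the chart \<open>c\<close> the velocity has the constant component
    \<open>w\<close>. The other charts around the point follow by the transition derivatives; in the
    remaining charts both sides are 0.\<close>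
  have velocity: "velocity M (simplex_path \<sigma>) t = coord_vector M c (g t) w" if t: "t \<in> {0..1}" for t
  proof
    fix d
    have x: "u + t *\<^sub>R w \<in> chart_image c" using seg[OF t] V(3) by blast
    have cg: "c \<in> charts_at M (g t)"
      using chart_inv_charts_at[OF c x] by (simp add: g_def)
    have sg: "snd c (g t) = u + t *\<^sub>R w"
      using x by (simp add: g_def)
    show "velocity M (simplex_path \<sigma>) t d = coord_vector M c (g t) w d"
    proof (cases "d \<in> charts_at M (g t)")
      case True
      have "((\<lambda>t. transition c d (u + t *\<^sub>R w)) has_derivative (\<lambda>s. dtrans c d (g t) (s *\<^sub>R w))) (at t within {0..1})"
        by (rule has_derivative_compose[of "\<lambda>t. u + t *\<^sub>R w" _ t _ "transition c d"])
          (use transition_has_derivative[OF cg True] in \<open>auto simp: sg intro!: derivative_eq_intros\<close>)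
      then have "((\<lambda>t. transition c d (u + t *\<^sub>R w)) has_vector_derivative dtrans c d (g t) w) (at t within {0..1})"
        by (simp add: has_vector_derivative_def linear_cmul[OF dtrans_linear[OF cg True]])
      then have "((snd d \<circ> simplex_path \<sigma>) has_vector_derivative dtrans c d (g t) w) (at t within {0..1})"
        by (rule has_vector_derivative_transform[OF t, rotated]) (simp add: path transition_def g_def)
      then have "vector_derivative (snd d \<circ> simplex_path \<sigma>) (at t within {0..1}) = dtrans c d (g t) w"
        using t vector_derivative_within_cbox[OF zero_less_one, of t "snd d \<circ> simplex_path \<sigma>"] by simp
      then show ?thesis
        using True by (simp add: velocity_def path[OF t] coord_vector_apply)
    next
      case False
      then show ?thesis
        by (simp add: velocity_def path[OF t] coord_vector_def)
    qed
  qed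
  have "((\<lambda>t. F (u + t *\<^sub>R w)) has_vector_derivative local_coeff M \<alpha> c w (u + t *\<^sub>R w)) (at t within {0..1})"
    if t: "t \<in> {0..1}" for t
  proof -
    have "((\<lambda>t. F (u + t *\<^sub>R w)) has_derivative (\<lambda>s. local_coeff M \<alpha> c (s *\<^sub>R w) (u + t *\<^sub>R w))) (at t within {0..1})"
      by (rule has_derivative_compose[of "\<lambda>t. u + t *\<^sub>R w" "\<lambda>s. s *\<^sub>R w" t _ F, OF _ F[OF seg[OF t]]])
        (auto intro!: derivative_eq_intros)
    moreover have "local_coeff M \<alpha> c (s *\<^sub>R w) (u + t *\<^sub>R w) = s *\<^sub>R local_coeff M \<alpha> c w (u + t *\<^sub>R w)" for s
      using linear_cmul[OF has_derivative_linear[OF F[OF seg[OF t]]]] .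
    ultimately show ?thesis
      by (simp add: has_vector_derivative_def)
  qed
  then have "((\<lambda>t. local_coeff M \<alpha> c w (u + t *\<^sub>R w)) has_integral F (u + 1 *\<^sub>R w) - F (u + 0 *\<^sub>R w)) {0..1}"
    by (intro fundamental_theorem_of_calculus) auto
  moreover have "\<alpha> (simplex_path \<sigma> t) (velocity M (simplex_path \<sigma>) t) = local_coeff M \<alpha> c w (u + t *\<^sub>R w)"
    if "t \<in> {0..1}" for t
    by (simp add: velocity[OF that] path[OF that] local_coeff_def g_def)
  ultimately have "((\<lambda>t. \<alpha> (simplex_path \<sigma> t) (velocity M (simplex_path \<sigma>) t)) has_integral F (u + w) - F u) {0..1}"
    by (subst has_integral_cong) auto
  then have "line_integral M \<alpha> (simplex_path \<sigma>) = F (snd c b) - F (snd c a)"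
    unfolding line_integral_def u_def w_def by (simp add: integral_unique)
  with simplex smooth_path boundary show ?thesis by blast
qed

end


section \<open>Integration over chains and periods\<close>

text \<open>Coefficients may cancel, so the support of a sum of chains can be smaller than the union
  of the supports. Over a common finite index set, additivity only concerns coefficients.\<close>

lemma chain_integral_superset:
  assumes "finite K" "Poly_Mapping.keys z \<subseteq> K"
  shows "chain_integral M \<alpha> z =
    (\<Sum>\<sigma>\<in>K. of_int (Poly_Mapping.lookup z \<sigma>) * line_integral M \<alpha> (simplex_path \<sigma>))"
  unfolding chain_integral_def
  by (rule sum.mono_neutral_left[OF assms]) (simp add: in_keys_iff)

lemma chain_integral_add: "chain_integral M \<alpha> (y + z) = chain_integral M \<alpha> y + chain_integral M \<alpha> z"
  and chain_integral_diff: "chain_integral M \<alpha> (y - z) = chain_integral M \<alpha> y - chain_integral M \<alpha> z"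
proof -
  let ?K = "Poly_Mapping.keys y \<union> Poly_Mapping.keys z"
  have K: "finite ?K" by simp
  note eq = chain_integral_superset[OF K]
  have y: "Poly_Mapping.keys y \<subseteq> ?K" and z: "Poly_Mapping.keys z \<subseteq> ?K" by auto
  show "chain_integral M \<alpha> (y + z) = chain_integral M \<alpha> y + chain_integral M \<alpha> z"
    unfolding eq[OF keys_add] eq[OF y] eq[OF z]
    by (simp add: lookup_add distrib_right sum.distrib)
  show "chain_integral M \<alpha> (y - z) = chain_integral M \<alpha> y - chain_integral M \<alpha> z"
    unfolding eq[OF keys_diff] eq[OF y] eq[OF z]
    by (simp add: lookup_minus left_diff_distrib sum_subtractf)
qed

lemma chain_integral_of: "chain_integral M \<alpha> (frag_of \<sigma>) = line_integral M \<alpha> (simplex_path \<sigma>)"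
  by (simp add: chain_integral_def)

lemma smooth_chain_add: "smooth_chain M y \<Longrightarrow> smooth_chain M z \<Longrightarrow> smooth_chain M (y + z)"
  unfolding smooth_chain_def using keys_add[of y z] by blast

lemma smooth_chain_diff: "smooth_chain M y \<Longrightarrow> smooth_chain M z \<Longrightarrow> smooth_chain M (y - z)"
  unfolding smooth_chain_def using keys_diff[of y z] by blast

text \<open>The condition in \<open>rational_H1\<close>, stated for a single form instead of for all
  members of a class.\<close>

definition rational_periods ::
    "('a, 'e::{real_inner,banach}) manifold \<Rightarrow> ('a \<Rightarrow> ('a, 'e) tvector \<Rightarrow> real) \<Rightarrow> bool" where
  "rational_periods M \<alpha> \<longleftrightarrow> (\<forall>h\<in>carrier (homology_group 1 (mtop M)).
     \<forall>z\<in>h. smooth_chain M z \<longrightarrow> chain_integral M \<alpha> z \<in> \<rat>)"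

lemma rational_periods_cycle:
  assumes "rational_periods M \<alpha>" "singular_chain 1 (mtop M) z" "chain_boundary 1 z = 0" "smooth_chain M z"
  shows "chain_integral M \<alpha> z \<in> \<rat>"
proof -
  have "singular_relcycle 1 (mtop M) {} z"
    using assms(2,3) by (simp add: singular_cycle)
  then have "homologous_rel_set 1 (mtop M) {} z \<in> carrier (homology_group 1 (mtop M))"
    using carrier_relative_homology_group[of 1 "mtop M" "{}"] by auto
  moreover have "z \<in> homologous_rel_set 1 (mtop M) {} z" by simp
  ultimately show ?thesis
    using assms(1,4) unfolding rational_periods_def by blast
qed

text \<open>For closed \<alpha>, \<open>x\<close> is one of the values at \<open>q\<close> of the
  multivalued primitive that is normalised to 0 at \<open>p\<close>. Chains are used instead of
  paths because a sum of smooth chains is smooth, whereas a concatenation of smooth paths may have a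
  corner.\<close>

definition reaches ::
    "('a, 'e::{real_inner,banach}) manifold \<Rightarrow> ('a \<Rightarrow> ('a, 'e) tvector \<Rightarrow> real) \<Rightarrow> 'a \<Rightarrow> 'a \<Rightarrow> real \<Rightarrow> bool" where
  "reaches M \<alpha> p q x \<longleftrightarrow> (\<exists>z. singular_chain 1 (mtop M) z \<and> smooth_chain M z \<and>
     chain_boundary 1 z = frag_of (point_simplex q) - frag_of (point_simplex p) \<and>
     chain_integral M \<alpha> z = x)"

lemma reaches_refl: "reaches M \<alpha> p p 0"
  unfolding reaches_def
  by (rule exI[of _ 0]) (simp add: smooth_chain_def chain_integral_def singular_chain_0 chain_boundary_0)

text \<open>In the boundary of the sum of the two chains the intermediate point cancels.\<close>

lemma reaches_trans:
  assumes "reaches M \<alpha> p q x" "reaches M \<alpha> q r y"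
  shows "reaches M \<alpha> p r (x + y)"
proof -
  obtain z z' where "singular_chain 1 (mtop M) z" "smooth_chain M z"
      "chain_boundary 1 z = frag_of (point_simplex q) - frag_of (point_simplex p)" "chain_integral M \<alpha> z = x"
      "singular_chain 1 (mtop M) z'" "smooth_chain M z'"
      "chain_boundary 1 z' = frag_of (point_simplex r) - frag_of (point_simplex q)" "chain_integral M \<alpha> z' = y"
    using assms unfolding reaches_def by blast
  then show ?thesis
    unfolding reaches_def
    by (intro exI[of _ "z + z'"])
      (simp add: singular_chain_add smooth_chain_add chain_boundary_add chain_integral_add)
qed

text \<open>Two chains with the same boundary differ by a smooth cycle, so \<open>x - y\<close> is a
  period.\<close>

lemma reaches_diff_rational:
  assumes "rational_periods M \<alpha>" "reaches M \<alpha> p q x" "reaches M \<alpha> p q y"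
  shows "x - y \<in> \<rat>"
proof -
  obtain z z' where z: "singular_chain 1 (mtop M) z" "smooth_chain M z"
      "chain_boundary 1 z = frag_of (point_simplex q) - frag_of (point_simplex p)" "chain_integral M \<alpha> z = x"
      "singular_chain 1 (mtop M) z'" "smooth_chain M z'"
      "chain_boundary 1 z' = frag_of (point_simplex q) - frag_of (point_simplex p)" "chain_integral M \<alpha> z' = y"
    using assms(2,3) unfolding reaches_def by blast
  have "chain_integral M \<alpha> (z - z') \<in> \<rat>"
    by (rule rational_periods_cycle[OF assms(1)])
      (simp_all del: One_nat_def add: z singular_chain_diff smooth_chain_diff chain_boundary_diff)
  then show ?thesis
    by (simp add: chain_integral_diff z)
qed

lemma common_denominator:
  assumes "finite A" "A \<subseteq> \<rat>"
  shows "\<exists>N::nat. N > 0 \<and> (\<forall>x\<in>A. of_nat N * x \<in> (\<int> :: real set))"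
  using assms
proof (induction A rule: finite_induct)
  case empty
  show ?case by (intro exI[of _ 1]) simp
next
  case (insert a A)
  then obtain N where N: "N > 0" "\<forall>x\<in>A. of_nat N * x \<in> \<int>" by auto
  obtain m n where mn: "n \<noteq> 0" "\<bar>a\<bar> = real m / real n"
    using insert.prems Rats_abs_nat_div_natE[of a] by (metis insert_subset)
  have "of_nat (n * N) * x \<in> \<int>" if "x \<in> A" for x
    using Ints_mult[OF Ints_of_nat[of n] N(2)[rule_format, OF that]] by (simp add: mult_ac)
  moreover have "of_nat (n * N) * a \<in> \<int>"
  proof -
    have "\<bar>of_nat n * a\<bar> = of_nat m"
      using mn by (simp add: abs_mult)
    then have "of_nat n * a \<in> \<int>"
      by (metis Ints_minus Ints_of_nat abs_eq_iff abs_of_nat)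
    then show ?thesis
      using Ints_mult[OF Ints_of_nat[of N]] by (force simp: mult_ac)
  qed
  ultimately show ?case
    using N(1) mn(1) by (intro exI[of _ "n * N"]) auto
qed

section \<open>Primitives normalised at a base point and their differences on overlaps\<close>

context smooth_mfd
begin

lemma primitive_on_openin: "primitive_on \<alpha> U f \<Longrightarrow> openin (mtop M) U"
  by (simp add: primitive_on_def)

lemma primitive_onD:
  "primitive_on \<alpha> U f \<Longrightarrow> p \<in> U \<Longrightarrow> c \<in> charts_at M p \<Longrightarrow>
    (f \<circ> chart_inv c has_derivative (\<lambda>e. \<alpha> p (coord_vector M c p e))) (at (snd c p))"
  by (simp add: primitive_on_def)

lemma primitive_on_add_const:
  assumes "primitive_on \<alpha> U f"
  shows "primitive_on \<alpha> U (\<lambda>p. f p + k)"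
  unfolding primitive_on_def
proof (intro conjI ballI)
  show "openin (mtop M) U" by (rule primitive_on_openin[OF assms])
  fix p c assume "p \<in> U" "c \<in> charts_at M p"
  from has_derivative_add_const[OF primitive_onD[OF assms this], of k]
  show "((\<lambda>p. f p + k) \<circ> chart_inv c has_derivative (\<lambda>e. \<alpha> p (coord_vector M c p e))) (at (snd c p))"
    by (simp add: o_def)
qed

text \<open>A ball inside a chart image is open and convex, so it carries a potential, and any two
  of its points are joined by a segment that realises the difference of the values.\<close>

lemma local_primitive:
  assumes \<alpha>: "\<alpha> \<in> closed_forms M" and p: "p \<in> points M"
  shows "\<exists>U f. p \<in> U \<and> primitive_on \<alpha> U f \<and> (\<forall>a\<in>U. \<forall>b\<in>U. reaches M \<alpha> a b (f b - f a))"
proof -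
  obtain c where cp: "c \<in> charts_at M p" using chart_exists[OF p] by blast
  note c = charts_atD(1)[OF cp]
  obtain r where r: "r > 0" "ball (snd c p) r \<subseteq> chart_image c"
    using open_chart_image[OF c] charts_atD(4)[OF cp] open_contains_ball by metis
  let ?V = "ball (snd c p) r"
  obtain F where F: "\<And>x. x \<in> ?V \<Longrightarrow> (F has_derivative (\<lambda>e. local_coeff M \<alpha> c e x)) (at x)"
    using chart_convex_primitive[OF \<alpha> c open_ball convex_ball r(2)] by blast
  have "reaches M \<alpha> a b ((F \<circ> snd c) b - (F \<circ> snd c) a)"
    if ab: "a \<in> chart_inv c ` ?V" "b \<in> chart_inv c ` ?V" for a b
  proof -
    obtain \<sigma> where "singular_simplex 1 (mtop M) \<sigma>" "smooth_path M (simplex_path \<sigma>)"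
        "chain_boundary 1 (frag_of \<sigma>) = frag_of (point_simplex b) - frag_of (point_simplex a)"
        "line_integral M \<alpha> (simplex_path \<sigma>) = F (snd c b) - F (snd c a)"
      using chart_segment[OF c open_ball convex_ball r(2) F ab] by blast
    then show ?thesis
      unfolding reaches_def
      by (intro exI[of _ "frag_of \<sigma>"])
        (simp add: singular_chain_of smooth_chain_def chain_integral_of)
  qed
  moreover have "p \<in> chart_inv c ` ?V"
    using r(1) charts_atD[OF cp] by (intro image_eqI[of _ _ "snd c p"]) auto
  ultimately show ?thesis
    using primitive_on_chartI[OF c open_ball r(2) F] by blast
qed

text \<open>Every point has a neighbourhood whose points reach each other. Such a neighbourhood lies
  inside the set reached from \<open>p0\<close> or misses it, so this set is open and
  closed.\<close>

lemma reaches_everywhere: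
  assumes \<alpha>: "\<alpha> \<in> closed_forms M" and conn: "connected_space (mtop M)"
    and p0: "p0 \<in> points M" and p: "p \<in> points M"
  shows "\<exists>x. reaches M \<alpha> p0 p x"
proof -
  define S where "S = {p \<in> points M. \<exists>x. reaches M \<alpha> p0 p x}"
  have patch: "\<exists>U. openin (mtop M) U \<and> q \<in> U \<and> (U \<subseteq> S \<or> U \<subseteq> points M - S)" if q: "q \<in> points M" for q
  proof -
    obtain U f where U: "q \<in> U" "primitive_on \<alpha> U f" "\<And>a b. a \<in> U \<Longrightarrow> b \<in> U \<Longrightarrow> reaches M \<alpha> a b (f b - f a)"
      using local_primitive[OF \<alpha> q] by blast
    have "U \<subseteq> points M"
      using openin_subset[OF primitive_on_openin[OF U(2)]] .
    moreover have "b \<in> S" if ab: "a \<in> U" "a \<in> S" "b \<in> U" for a b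
    proof -
      obtain x where "reaches M \<alpha> p0 a x" using ab(2) unfolding S_def by blast
      from reaches_trans[OF this U(3)[OF ab(1,3)]] show ?thesis
        using ab(3) \<open>U \<subseteq> points M\<close> unfolding S_def by blast
    qed
    ultimately show ?thesis
      using U(1) primitive_on_openin[OF U(2)] by blast
  qed
  have "openin (mtop M) S"
  proof (subst openin_subopen, intro ballI)
    fix q assume q: "q \<in> S"
    then obtain U where "openin (mtop M) U" "q \<in> U" "U \<subseteq> S \<or> U \<subseteq> points M - S"
      using patch[of q] unfolding S_def by blast
    then show "\<exists>T. openin (mtop M) T \<and> q \<in> T \<and> T \<subseteq> S"
      using q by blast
  qed
  moreover have "openin (mtop M) (points M - S)"
  proof (subst openin_subopen, intro ballI)
    fix q assume q: "q \<in> points M - S"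
    then obtain U where "openin (mtop M) U" "q \<in> U" "U \<subseteq> S \<or> U \<subseteq> points M - S"
      using patch[of q] by blast
    then show "\<exists>T. openin (mtop M) T \<and> q \<in> T \<and> T \<subseteq> points M - S"
      using q by blast
  qed
  then have "closedin (mtop M) S"
    by (simp add: closedin_def S_def)
  ultimately have "S = {} \<or> S = points M"
    using conn unfolding connected_space_clopen_in by blast
  moreover have "p0 \<in> S"
    using p0 reaches_refl[of M \<alpha> p0] unfolding S_def by auto
  ultimately show ?thesis
    using p unfolding S_def by blast
qed

text \<open>A constant is added so that the values become integrals over chains from the common base
  point \<open>p0\<close>. Then \<open>reaches_diff_rational\<close> applies to the difference of
  any two of these primitives.\<close>

lemma normalised_primitive:
  assumes \<alpha>: "\<alpha> \<in> closed_forms M" and conn: "connected_space (mtop M)"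
    and p0: "p0 \<in> points M" and p: "p \<in> points M"
  shows "\<exists>U f. p \<in> U \<and> primitive_on \<alpha> U f \<and> (\<forall>q\<in>U. reaches M \<alpha> p0 q (f q))"
proof -
  obtain U f where U: "p \<in> U" "primitive_on \<alpha> U f" "\<forall>a\<in>U. \<forall>b\<in>U. reaches M \<alpha> a b (f b - f a)"
    using local_primitive[OF \<alpha> p] by blast
  obtain y where y: "reaches M \<alpha> p0 p y"
    using reaches_everywhere[OF \<alpha> conn p0 p] by blast
  have "reaches M \<alpha> p0 q (f q + (y - f p))" if "q \<in> U" for q
    using reaches_trans[OF y U(3)[rule_format, OF U(1) that]] by (simp add: algebra_simps)
  then show ?thesis
    using U(1) primitive_on_add_const[OF U(2), of "y - f p"] by blast
qed

text \<open>In a chart ball the difference has derivative 0 and is therefore constant. The statement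
  speaks of level sets because these will serve as an open cover.\<close>

lemma primitives_differ_locally_constant:
  assumes f: "primitive_on \<alpha> U f" and g: "primitive_on \<alpha> V g"
  shows "openin (mtop M) {q \<in> U \<inter> V. f q - g q = r}"
proof (subst openin_subopen, intro ballI)
  fix q assume q: "q \<in> {q \<in> U \<inter> V. f q - g q = r}"
  have UV: "openin (mtop M) (U \<inter> V)"
    using primitive_on_openin[OF f] primitive_on_openin[OF g] by (rule openin_Int)
  obtain c where cq: "c \<in> charts_at M q"
    using chart_exists[of q] q openin_subset[OF UV] by blast
  note c = charts_atD(1)[OF cq]
  have "snd c q \<in> snd c ` (fst c \<inter> (U \<inter> V))"
    using q charts_atD(2)[OF cq] by blast
  then obtain \<rho> where \<rho>: "\<rho> > 0" "ball (snd c q) \<rho> \<subseteq> snd c ` (fst c \<inter> (U \<inter> V))"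
    using open_image_chart[OF c UV] open_contains_ball by metis
  let ?B = "ball (snd c q) \<rho>"
  have B: "?B \<subseteq> chart_image c" "chart_inv c x \<in> U \<inter> V" if "x \<in> ?B" for x
    using \<rho>(2) that c by (auto simp: chart_image_def)
  define h where "h x = f (chart_inv c x) - g (chart_inv c x)" for x
  have "(h has_derivative (\<lambda>e. 0)) (at x within ?B)" if x: "x \<in> ?B" for x
  proof -
    have xi: "x \<in> chart_image c" using B(1)[OF x] x by blast
    have "(h has_derivative (\<lambda>e. 0)) (at x)"
      using has_derivative_diff[OF primitive_onD[OF f _ chart_inv_charts_at[OF c xi]]
          primitive_onD[OF g _ chart_inv_charts_at[OF c xi]]] B(2)[OF x]
      by (simp add: h_def[abs_def] o_def xi)
    then show ?thesis by (rule has_derivative_at_withinI)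
  qed
  then obtain k where k: "\<And>x. x \<in> ?B \<Longrightarrow> h x = k"
    using has_derivative_zero_constant[OF convex_ball, of "snd c q" \<rho> h] by blast
  have "h (snd c q) = f q - g q"
    using charts_atD(2)[OF cq] c by (simp add: h_def)
  then have "k = r"
    using k[of "snd c q"] \<rho>(1) q by simp
  then have "chart_inv c ` ?B \<subseteq> {q \<in> U \<inter> V. f q - g q = r}"
    using k B(2) by (auto simp: h_def)
  moreover have "q \<in> chart_inv c ` ?B"
    using \<rho>(1) charts_atD[OF cq] by (intro image_eqI[of _ _ "snd c q"]) auto
  moreover have "openin (mtop M) (chart_inv c ` ?B)"
    using \<rho>(1) by (intro openin_image_chart_inv[OF c open_ball B(1)[of "snd c q"]]) simp
  ultimately show "\<exists>T. openin (mtop M) T \<and> q \<in> T \<and> T \<subseteq> {q \<in> U \<inter> V. f q - g q = r}"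
    by blast
qed

text \<open>The level sets of the difference cover \<open>K\<close> by open sets, and a finite
  subcover leaves finitely many values. On \<open>U \<inter> V\<close> itself, which may have
  infinitely many components, there could be infinitely many.\<close>

lemma primitives_differ_finite:
  assumes f: "primitive_on \<alpha> U f" and g: "primitive_on \<alpha> V g"
    and K: "compactin (mtop M) K" "K \<subseteq> U \<inter> V"
  shows "finite ((\<lambda>q. f q - g q) ` K)"
proof -
  define \<U> where "\<U> = range (\<lambda>r. {q \<in> U \<inter> V. f q - g q = r})"
  have "K \<subseteq> \<Union>\<U>" using K(2) unfolding \<U>_def by auto
  moreover have "openin (mtop M) T" if "T \<in> \<U>" for T
    using that primitives_differ_locally_constant[OF f g] unfolding \<U>_def by blast
  ultimately obtain \<F> where \<F>: "finite \<F>" "\<F> \<subseteq> \<U>" "K \<subseteq> \<Union>\<F>"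
    using compactinD[OF K(1), of \<U>] by blast
  obtain R where R: "finite R" "\<F> = (\<lambda>r. {q \<in> U \<inter> V. f q - g q = r}) ` R"
    using finite_subset_image[OF \<F>(1) \<F>(2)[unfolded \<U>_def]] by blast
  then have "(\<lambda>q. f q - g q) ` K \<subseteq> R"
    using \<F>(3) by auto
  then show ?thesis using R(1) finite_subset by blast
qed

end


section \<open>Circle-valued primitives and basic forms\<close>

context smooth_mfd
begin

lemma smooth_function_has_derivative:
  assumes "f \<in> smooth_functions M" "c \<in> charts_at M p"
  shows "(f \<circ> chart_inv c has_derivative frechet_derivative (f \<circ> chart_inv c) (at (snd c p))) (at (snd c p))"
  using assms charts_atD[OF assms(2)]
  by (intro smooth_on_has_derivative[of "chart_image c"]) (simp_all add: smooth_functions_def)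

section \<open>Coboundaries, and the image of basic cohomology in de Rham cohomology\<close>

lemma smooth_functions_zero: "(\<lambda>p. 0) \<in> smooth_functions M"
  using open_chart_image by (simp add: smooth_functions_def smooth_on_def o_def Ck_on_const)

lemma smooth_functions_add:
  assumes "f \<in> smooth_functions M" "g \<in> smooth_functions M"
  shows "(\<lambda>p. f p + g p) \<in> smooth_functions M"
  unfolding smooth_functions_def
proof (intro CollectI ballI)
  fix c assume c: "c \<in> atlas M"
  have "Ck_on k (chart_image c) (f \<circ> chart_inv c)" "Ck_on k (chart_image c) (g \<circ> chart_inv c)" for k
    using assms c by (simp_all add: smooth_functions_def smooth_on_def)
  note Ck_on_add[OF open_chart_image[OF c] this]
  then show "smooth_on (chart_image c) ((\<lambda>p. f p + g p) \<circ> chart_inv c)"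
    by (simp add: smooth_on_def o_def)
qed

lemma d0_zero: "d0 M (\<lambda>p. 0) p v = 0"
proof (cases "p \<in> points M \<and> v \<in> tangent_space M p")
  case True
  then obtain c where c: "c \<in> charts_at M p" using chart_exists by blast
  have "((\<lambda>p. 0) \<circ> chart_inv c has_derivative (\<lambda>e. 0)) (at (snd c p))"
    by (simp add: o_def)
  from d0_eq[OF c _ this] True show ?thesis by blast
qed (auto simp: d0_def)

lemma d0_add:
  assumes "f \<in> smooth_functions M" "g \<in> smooth_functions M"
  shows "d0 M (\<lambda>p. f p + g p) p v = d0 M f p v + d0 M g p v"
proof (cases "p \<in> points M \<and> v \<in> tangent_space M p")
  case True
  then obtain c where c: "c \<in> charts_at M p" using chart_exists by blast
  note f = smooth_function_has_derivative[OF assms(1) c]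
  note g = smooth_function_has_derivative[OF assms(2) c]
  have "((\<lambda>p. f p + g p) \<circ> chart_inv c has_derivative
      (\<lambda>e. frechet_derivative (f \<circ> chart_inv c) (at (snd c p)) e +
           frechet_derivative (g \<circ> chart_inv c) (at (snd c p)) e)) (at (snd c p))"
    using has_derivative_add[OF f g] by (simp add: o_def)
  from d0_eq[OF c _ this] d0_eq[OF c _ f] d0_eq[OF c _ g] True show ?thesis by simp
qed (auto simp: d0_def)

lemma cohomologous_via_refl:
  assumes "\<alpha> \<in> Z" "(\<lambda>p. 0) \<in> \<Omega>"
  shows "(\<alpha>, \<alpha>) \<in> cohomologous_via M \<Omega> Z"
  using assms d0_zero unfolding cohomologous_via_def by force

lemma deRham_rel_trans:
  assumes "(\<alpha>, \<beta>) \<in> deRham_rel M" "(\<beta>, \<gamma>) \<in> deRham_rel M"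
  shows "(\<alpha>, \<gamma>) \<in> deRham_rel M"
proof -
  obtain f g where "f \<in> smooth_functions M" "g \<in> smooth_functions M"
      "\<beta> = (\<lambda>p v. \<alpha> p v + d0 M f p v)" "\<gamma> = (\<lambda>p v. \<beta> p v + d0 M g p v)"
    and "\<alpha> \<in> closed_forms M" "\<gamma> \<in> closed_forms M"
    using assms unfolding deRham_rel_def cohomologous_via_def by blast
  then have "\<gamma> = (\<lambda>p v. \<alpha> p v + d0 M (\<lambda>p. f p + g p) p v)" "(\<lambda>p. f p + g p) \<in> smooth_functions M"
    by (simp_all add: d0_add smooth_functions_add add.assoc)
  with \<open>\<alpha> \<in> closed_forms M\<close> \<open>\<gamma> \<in> closed_forms M\<close> show ?thesis
    unfolding deRham_rel_def cohomologous_via_def by blast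
qed

lemma basic_functions_zero: "(\<lambda>p. 0) \<in> basic_functions M F"
  by (simp add: basic_functions_def smooth_functions_zero d0_zero)

text \<open>Basic coboundaries are de Rham coboundaries, so a basic class is sent to the de Rham
  class of any of its representatives. Comparing two foliations thus becomes a comparison of their
  closed basic forms.\<close>

lemma basic_to_deRham_image:
  "basic_to_deRham M ` basic_H1 M F =
    (\<lambda>\<alpha>. deRham_rel M `` {\<alpha>}) ` (basic_one_forms M F \<inter> closed_forms M)"
proof -
  let ?Z = "basic_one_forms M F \<inter> closed_forms M"
  let ?R = "cohomologous_via M (basic_functions M F) ?Z"
  have sub: "?R \<subseteq> deRham_rel M"
    unfolding deRham_rel_def cohomologous_via_def basic_functions_def by blast
  have "basic_to_deRham M (?R `` {\<alpha>}) = deRham_rel M `` {\<alpha>}" if "\<alpha> \<in> ?Z" for \<alpha>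
    using cohomologous_via_refl[OF that basic_functions_zero] sub deRham_rel_trans
    unfolding basic_to_deRham_def by blast
  then show ?thesis
    unfolding basic_H1_def quotient_def by auto
qed

text \<open>The two functions are the cosine and the sine of a multivalued primitive of the form. The
  multiple \<open>\<kappa>\<close> turns all the jumps of the primitive into multiples of \<open>2 \<pi>\<close>.\<close>

lemma circle_valued_primitive:
  assumes \<alpha>: "\<alpha> \<in> closed_forms M" and rat: "rational_periods M \<alpha>"
    and compact: "compact_space (mtop M)" and conn: "connected_space (mtop M)"
  shows "\<exists>\<kappa> C S. \<kappa> \<noteq> 0 \<and> C \<in> smooth_functions M \<and> S \<in> smooth_functions M \<and>
    (\<forall>p\<in>points M. (C p)\<^sup>2 + (S p)\<^sup>2 = 1) \<and>
    (\<forall>p\<in>points M. \<forall>v\<in>tangent_space M p.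
      d0 M C p v = - (\<kappa> * S p * \<alpha> p v) \<and> d0 M S p v = \<kappa> * C p * \<alpha> p v)"
proof -
  \<comment> \<open>The disjunction covers the empty manifold, where the claims about points are
    vacuous.\<close>
  obtain p0 where p0: "p0 \<in> points M \<or> points M = {}" by blast
  have "Hausdorff_space (mtop M)"
    using smooth_manifold by (simp add: smooth_manifold_def)
  then have regular: "neighbourhood_base_of (closedin (mtop M)) (mtop M)"
    using compact by (simp add: neighbourhood_base_of_closedin compact_Hausdorff_imp_regular_space)
  \<comment> \<open>Regularity of a compact Hausdorff space places a closed, hence compact,
    \<open>K\<close> between the open set \<open>V\<close>, used for covering, and the domain
    \<open>U\<close> of the primitive.\<close>
  have "\<exists>U V K f. p \<in> V \<and> V \<subseteq> K \<and> K \<subseteq> U \<and> openin (mtop M) V \<and> compactin (mtop M) K \<and>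
      primitive_on \<alpha> U f \<and> (\<forall>q\<in>U. reaches M \<alpha> p0 q (f q))" if p: "p \<in> points M" for p
  proof -
    obtain U f where U: "p \<in> U" "primitive_on \<alpha> U f" "\<forall>q\<in>U. reaches M \<alpha> p0 q (f q)"
      using normalised_primitive[OF \<alpha> conn _ p, of p0] p0 p by blast
    obtain V K where VK: "openin (mtop M) V" "closedin (mtop M) K" "p \<in> V" "V \<subseteq> K" "K \<subseteq> U"
      using regular[unfolded neighbourhood_base_of, rule_format, OF conjI[OF primitive_on_openin[OF U(2)] U(1)]]
      by blast
    then show ?thesis
      by (intro exI[of _ U] exI[of _ V] exI[of _ K] exI[of _ f])
        (simp add: U closedin_compact_space[OF compact])
  qed
  then obtain U V K f where loc: "\<And>p. p \<in> points M \<Longrightarrow> p \<in> V p \<and> V p \<subseteq> K p \<and> K p \<subseteq> U p \<and>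
      openin (mtop M) (V p) \<and> compactin (mtop M) (K p) \<and> primitive_on \<alpha> (U p) (f p) \<and>
      (\<forall>q\<in>U p. reaches M \<alpha> p0 q (f p q))"
    by metis
  have "compactin (mtop M) (points M)"
    using compact by (simp add: compact_space_def)
  moreover have "openin (mtop M) T" if "T \<in> V ` points M" for T
    using that loc by auto
  moreover have "points M \<subseteq> \<Union>(V ` points M)"
    using loc by auto
  ultimately obtain \<F> where \<F>: "finite \<F>" "\<F> \<subseteq> V ` points M" "points M \<subseteq> \<Union>\<F>"
    using compactinD[of "mtop M" "points M" "V ` points M"] by metis
  obtain I where I: "finite I" "I \<subseteq> points M" "\<F> = V ` I"
    using finite_subset_image[OF \<F>(1,2)] by blast
  \<comment> \<open>All jumps on the compact overlaps: finitely many by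
    \<open>primitives_differ_finite\<close>, and rational because all the primitives are normalised
    at \<open>p0\<close>.\<close>
  define D where "D = (\<Union>i\<in>I. \<Union>j\<in>I. (\<lambda>q. f i q - f j q) ` (K i \<inter> K j))"
  have locI: "V i \<subseteq> K i" "K i \<subseteq> U i" "openin (mtop M) (V i)" "compactin (mtop M) (K i)"
    "primitive_on \<alpha> (U i) (f i)" "\<And>q. q \<in> U i \<Longrightarrow> reaches M \<alpha> p0 q (f i q)" if "i \<in> I" for i
    using loc[of i] that I(2) by blast+
  have "finite ((\<lambda>q. f i q - f j q) ` (K i \<inter> K j))" if ij: "i \<in> I" "j \<in> I" for i j
  proof (rule primitives_differ_finite[OF locI(5)[OF ij(1)] locI(5)[OF ij(2)]])
    show "compactin (mtop M) (K i \<inter> K j)"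
      using locI(4)[OF ij(1)] locI(4)[OF ij(2)] \<open>Hausdorff_space (mtop M)\<close>
      by (intro closed_Int_compactin compactin_imp_closedin)
    show "K i \<inter> K j \<subseteq> U i \<inter> U j"
      using locI(2)[OF ij(1)] locI(2)[OF ij(2)] by blast
  qed
  then have "finite D"
    unfolding D_def using I(1) by blast
  moreover have "D \<subseteq> \<rat>"
    unfolding D_def using locI(2,6) reaches_diff_rational[OF rat] by blast
  ultimately obtain N :: nat where N: "N > 0" "\<And>x. x \<in> D \<Longrightarrow> of_nat N * x \<in> \<int>"
    using common_denominator[of D] by metis
  define \<kappa> where "\<kappa> = 2 * pi * of_nat N"
  \<comment> \<open>The chosen index may vary with \<open>p\<close> without any continuity;
    \<open>CS\<close> shows that cosine and sine do not depend on it.\<close>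
  define \<iota> where "\<iota> p = (SOME i. i \<in> I \<and> p \<in> V i)" for p
  define C where "C p = cos (\<kappa> * f (\<iota> p) p)" for p
  define S where "S p = sin (\<kappa> * f (\<iota> p) p)" for p
  have \<iota>: "\<iota> p \<in> I \<and> p \<in> V (\<iota> p)" if "p \<in> points M" for p
    unfolding \<iota>_def by (rule someI_ex) (use that \<F>(3) I(3) in blast)
  have CS: "C p = cos (\<kappa> * f i p) \<and> S p = sin (\<kappa> * f i p)" if i: "i \<in> I" "p \<in> V i" for i p
  proof -
    have p: "p \<in> points M"
      using openin_subset[OF locI(3)[OF i(1)]] i(2) by blast
    have "p \<in> K (\<iota> p) \<inter> K i"
      using locI(1)[OF i(1)] i(2) locI(1)[OF conjunct1[OF \<iota>[OF p]]] \<iota>[OF p] by blast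
    then have "f (\<iota> p) p - f i p \<in> D"
      unfolding D_def by (intro UN_I[of "\<iota> p"] UN_I[of i] imageI) (simp_all add: i \<iota>[OF p])
    from N(2)[OF this] obtain m where m: "of_nat N * (f (\<iota> p) p - f i p) = of_int m"
      by (auto elim: Ints_cases)
    have "\<kappa> * f (\<iota> p) p = \<kappa> * f i p + 2 * pi * (of_nat N * (f (\<iota> p) p - f i p))"
      by (simp add: \<kappa>_def algebra_simps)
    then have "\<kappa> * f (\<iota> p) p = \<kappa> * f i p + 2 * pi * of_int m"
      by (simp only: m)
    then show ?thesis
      using sin_cos_eq_iff[of "\<kappa> * f (\<iota> p) p" "\<kappa> * f i p"] unfolding C_def S_def by blast
  qed
  \<comment> \<open>The index is frozen at \<open>i = \<iota> p\<close> before differentiating: near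
    \<open>p\<close> the functions \<open>C\<close> and \<open>S\<close> agree with cosine and sine
    of \<open>\<kappa> * f i\<close>, even where \<iota> takes other values.\<close>
  have der: "(C \<circ> chart_inv c has_derivative (\<lambda>e. - (\<kappa> * S p * \<alpha> p (coord_vector M c p e)))) (at (snd c p)) \<and>
      (S \<circ> chart_inv c has_derivative (\<lambda>e. \<kappa> * C p * \<alpha> p (coord_vector M c p e))) (at (snd c p))"
    if cp: "c \<in> charts_at M p" for c p
  proof -
    note c = charts_atD[OF cp]
    define i where "i = \<iota> p"
    have i: "i \<in> I" "p \<in> V i"
      using \<iota>[OF c(3)] by (simp_all add: i_def)
    have "p \<in> U i" using i locI by blast
    note df = primitive_onD[OF locI(5)[OF i(1)] this cp, unfolded o_def]
    let ?O = "snd c ` (fst c \<inter> V i)"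
    have O: "open ?O" "snd c p \<in> ?O"
      using open_image_chart[OF c(1) locI(3)[OF i(1)]] c(2) i(2) by auto
    have eq: "cos (\<kappa> * f i (chart_inv c x)) = (C \<circ> chart_inv c) x"
      "sin (\<kappa> * f i (chart_inv c x)) = (S \<circ> chart_inv c) x" if "x \<in> ?O" for x
      using that CS[OF i(1)] c(1) by auto
    have dk: "((\<lambda>x. \<kappa> * f i (chart_inv c x)) has_derivative (\<lambda>e. \<kappa> * \<alpha> p (coord_vector M c p e))) (at (snd c p))"
      by (rule has_derivative_mult_right[OF df])
    have pp: "chart_inv c (snd c p) = p" using c by simp
    have dC: "((\<lambda>x. cos (\<kappa> * f i (chart_inv c x))) has_derivative
        (\<lambda>e. - (\<kappa> * S p * \<alpha> p (coord_vector M c p e)))) (at (snd c p))"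
      using has_derivative_cos[OF dk] CS[OF i] by (simp add: pp mult_ac)
    have dS: "((\<lambda>x. sin (\<kappa> * f i (chart_inv c x))) has_derivative
        (\<lambda>e. \<kappa> * C p * \<alpha> p (coord_vector M c p e))) (at (snd c p))"
      using has_derivative_sin[OF dk] CS[OF i] by (simp add: pp mult_ac)
    show ?thesis
      by (intro conjI has_derivative_transform_within_open[OF dC O]
          has_derivative_transform_within_open[OF dS O]) (simp_all only: eq)
  qed
  have "smooth_on (chart_image c) (C \<circ> chart_inv c) \<and> smooth_on (chart_image c) (S \<circ> chart_inv c)"
    if c: "c \<in> atlas M" for c
  \<comment> \<open>The primitives \<open>f i\<close> are only known to be differentiable.
    Smoothness of \<open>C\<close> and \<open>S\<close> comes from the differential equations in
    \<open>der\<close> and the smooth coefficients of \<alpha>.\<close>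
  proof (rule smooth_on_trig_pair[OF open_chart_image[OF c]])
    fix x assume x: "x \<in> chart_image c"
    show "(C \<circ> chart_inv c has_derivative (\<lambda>e. - (\<kappa> * (S \<circ> chart_inv c) x * local_coeff M \<alpha> c e x))) (at x)"
      "(S \<circ> chart_inv c has_derivative (\<lambda>e. \<kappa> * (C \<circ> chart_inv c) x * local_coeff M \<alpha> c e x)) (at x)"
      using der[OF chart_inv_charts_at[OF c x]] x by (simp_all add: local_coeff_def)
  next
    show "smooth_on (chart_image c) (\<lambda>x. local_coeff M \<alpha> c e x)" for e
      using \<alpha> c by (simp add: closed_forms_def one_forms_def)
  qed
  then have "C \<in> smooth_functions M" "S \<in> smooth_functions M"
    by (simp_all add: smooth_functions_def)
  moreover have "d0 M C p v = - (\<kappa> * S p * \<alpha> p v) \<and> d0 M S p v = \<kappa> * C p * \<alpha> p v"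
    if p: "p \<in> points M" and v: "v \<in> tangent_space M p" for p v
  proof -
    obtain c where c: "c \<in> charts_at M p" using chart_exists[OF p] by blast
    show ?thesis
      using d0_eq[OF c v conjunct1[OF der[OF c]]] d0_eq[OF c v conjunct2[OF der[OF c]]]
      by (simp add: tangent_eq_coord_vector[OF v c])
  qed
  moreover have "\<kappa> \<noteq> 0" "(C p)\<^sup>2 + (S p)\<^sup>2 = 1" for p
    using N(1) by (simp_all add: \<kappa>_def C_def S_def)
  ultimately show ?thesis by blast
qed

section \<open>Fields and closed forms for the foliation and its basic foliation\<close>

lemma tangent_fields_D:
  assumes "X \<in> tangent_fields M F" "p \<in> points M"
  shows "X p \<in> tangent_space M p" "X p \<in> leaf_tangent M F p"
  using assms unfolding tangent_fields_def leaf_tangent_def by blast+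

text \<open>For a closed form the condition on \<open>d1\<close> is automatic, so only the values on
  fields tangent to \<open>Fb\<close> matter. On them dC and dS vanish; as \<open>C\<close> and
  \<open>S\<close> have no common zero and \<kappa> is nonzero, \<alpha> vanishes too.\<close>

lemma rational_basic_form_basic_foliation:
  assumes compact: "compact_space (mtop M)" and conn: "connected_space (mtop M)"
    and \<alpha>: "\<alpha> \<in> basic_one_forms M F" "\<alpha> \<in> closed_forms M" and rat: "rational_periods M \<alpha>"
    and Fb: "basic_foliation M F Fb"
  shows "\<alpha> \<in> basic_one_forms M Fb"
proof -
  obtain \<kappa> C S where \<kappa>: "\<kappa> \<noteq> 0" and CS: "C \<in> smooth_functions M" "S \<in> smooth_functions M"
    and one: "\<And>p. p \<in> points M \<Longrightarrow> (C p)\<^sup>2 + (S p)\<^sup>2 = 1"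
    and d: "\<And>p v. p \<in> points M \<Longrightarrow> v \<in> tangent_space M p \<Longrightarrow> d0 M C p v = - (\<kappa> * S p * \<alpha> p v)"
      "\<And>p v. p \<in> points M \<Longrightarrow> v \<in> tangent_space M p \<Longrightarrow> d0 M S p v = \<kappa> * C p * \<alpha> p v"
    using circle_valued_primitive[OF \<alpha>(2) rat compact conn] by blast
  have "\<alpha> p (X p) = 0" if "X \<in> tangent_fields M F" "p \<in> points M" for X p
    using \<alpha>(1) that unfolding basic_one_forms_def by blast
  then have basic: "C \<in> basic_functions M F" "S \<in> basic_functions M F"
    using CS d tangent_fields_D(1) by (simp_all add: basic_functions_def)
  have zero: "\<alpha> p (X p) = 0" if X: "X \<in> tangent_fields M Fb" and p: "p \<in> points M" for X p
  proof -
    \<comment> \<open>By definition of the basic foliation, the vector \<open>X p\<close> extends to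
      a global field annihilating all basic functions. This \<open>Y\<close> depends on
      \<open>p\<close>, and only its value there is used.\<close>
    obtain Y where Y: "Y p = X p" "\<And>f. f \<in> basic_functions M F \<Longrightarrow> d0 M f p (Y p) = 0"
      using tangent_fields_D(2)[OF X p] Fb p unfolding basic_foliation_def by force
    have "\<kappa> * S p * \<alpha> p (X p) = 0" "\<kappa> * C p * \<alpha> p (X p) = 0"
      using Y(2)[OF basic(1)] Y(2)[OF basic(2)] Y(1) d[OF p tangent_fields_D(1)[OF X p]] by simp_all
    then show ?thesis
      using \<kappa> one[OF p] by auto
  qed
  then show ?thesis
    using \<alpha>(2) tangent_fields_D(1) unfolding basic_one_forms_def closed_forms_def by blast
qed

text \<open>A field tangent to \<open>F\<close> annihilates the basic functions by their definition,
  so it is itself the required witness at every point.\<close>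

lemma tangent_fields_basic_foliation:
  assumes "basic_foliation M F Fb"
  shows "tangent_fields M F \<subseteq> tangent_fields M Fb"
proof
  fix X assume X: "X \<in> tangent_fields M F"
  then have "\<forall>f\<in>basic_functions M F. \<forall>x\<in>points M. d0 M f x (X x) = 0"
    by (simp add: basic_functions_def)
  then show "X \<in> tangent_fields M Fb"
    using X assms unfolding tangent_fields_def basic_foliation_def by blast
qed

text \<open>The class contains \<alpha> by reflexivity, so the condition on all members of the class
  applies to it.\<close>

lemma rational_H1_periods:
  assumes "\<alpha> \<in> closed_forms M" "deRham_rel M `` {\<alpha>} \<in> rational_H1 M"
  shows "rational_periods M \<alpha>"
proof -
  have "(\<alpha>, \<alpha>) \<in> deRham_rel M"
    unfolding deRham_rel_def by (rule cohomologous_via_refl[OF assms(1) smooth_functions_zero])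
  then show ?thesis
    using assms(2) unfolding rational_H1_def rational_periods_def by blast
qed

end

theorem proposition3p5:
  fixes M :: "('a, 'e::{real_inner,banach}) manifold"
    and F Fb :: "'a set set"
    and q :: nat
  assumes "smooth_manifold M"
    and "compact_space (mtop M)"
    and "connected_space (mtop M)"
    and "foliation M q F"
    and "transversely_parallelizable M q F"
    and "basic_foliation M F Fb"
  shows "basic_H1_rational M F = basic_H1_rational M Fb"
proof -
  interpret smooth_mfd M by unfold_locales (rule assms(1))
  \<comment> \<open>More tangent fields impose more conditions on a form, so the inclusion of fields
    is reversed.\<close>
  have "basic_one_forms M Fb \<subseteq> basic_one_forms M F"
    using tangent_fields_basic_foliation[OF assms(6)] unfolding basic_one_forms_def by blast
  moreover have "\<alpha> \<in> basic_one_forms M Fb"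
    if "\<alpha> \<in> basic_one_forms M F" "\<alpha> \<in> closed_forms M" "deRham_rel M `` {\<alpha>} \<in> rational_H1 M" for \<alpha>
    using rational_basic_form_basic_foliation[OF assms(2,3) that(1,2) rational_H1_periods[OF that(2,3)] assms(6)] .
  ultimately show ?thesis
    unfolding basic_H1_rational_def basic_to_deRham_image by blast
qed

end
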